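(* Let $$f_\infty(r)=\begin{cases}\dfrac{r}{\sqrt2}, & r<\sqrt2,\\[1mm] 1, & r\ge\sqrt2.\end{cases}$$ There exists $C>0$ such that for every $p>2$ we have $$\|f_p-f_\infty\|_{L^\infty(\mathbb{R}_+)}\le C\Big(\frac{\ln p}{p}\Big)^{1/2}.$$
   Context: For $p>2$ let $$X_p=\Big\{f\in W^{1,p}_{\mathrm{loc}}(0,\infty):\ \int_0^\infty\big(|f'|^2+\tfrac{f^2}{r^2}\big)^{p/2}\,r\,dr<\infty\Big\}$$ (real-valued functions; every $f\in X_p$ has a continuous representative on $[0,\infty)$ with $f(0)=0$), and $$I_p(f)=\int_0^\infty\Big\{\Big[(f')^2+\frac{f^2}{r^2}\Big]^{p/2}+\frac12(1-f^2)^2\Big\}\,r\,dr.$$ $f_p$ denotes the unique non-negative minimizer of $I_p$ over $X_p$. Here $\mathbb{R}_+=(0,\infty)$. *)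

theory Defs
  imports "HOL-Analysis.Analysis" "HOL-Probability.Essential_Supremum"
begin

text \<open>Elements of the function spaces below are plain functions standing for their classes modulo
  equality almost everywhere; only their values on the open set \<open>\<Omega>\<close> matter.\<close>

text \<open>\<open>C\<close>-infinity functions with compact support in \<open>\<Omega>\<close>, extended by zero to the whole line.\<close>

definition test_function :: "real set \<Rightarrow> (real \<Rightarrow> real) \<Rightarrow> bool" where
  "test_function \<Omega> \<phi> \<longleftrightarrow>
     (\<forall>n x. (deriv ^^ n) \<phi> differentiable (at x)) \<and>
     compact (closure {x. \<phi> x \<noteq> 0}) \<and> closure {x. \<phi> x \<noteq> 0} \<subseteq> \<Omega>"

definition Lp_loc :: "real set \<Rightarrow> real \<Rightarrow> (real \<Rightarrow> real) set" where
  "Lp_loc \<Omega> p = {f \<in> borel_measurable (lebesgue_on \<Omega>).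
     \<forall>K. compact K \<and> K \<subseteq> \<Omega> \<longrightarrow> (\<integral>\<^sup>+x. ennreal (\<bar>f x\<bar> powr p) \<partial>(lebesgue_on K)) < \<infinity>}"

definition is_weak_deriv :: "real set \<Rightarrow> (real \<Rightarrow> real) \<Rightarrow> (real \<Rightarrow> real) \<Rightarrow> bool" where
  "is_weak_deriv \<Omega> f g \<longleftrightarrow> f \<in> Lp_loc \<Omega> 1 \<and> g \<in> Lp_loc \<Omega> 1 \<and>
     (\<forall>\<phi>. test_function \<Omega> \<phi> \<longrightarrow>
        (\<integral>x. f x * deriv \<phi> x \<partial>(lebesgue_on \<Omega>)) = - (\<integral>x. g x * \<phi> x \<partial>(lebesgue_on \<Omega>)))"

text \<open>A weak derivative is determined up to a null set, so the choice does not affect integrals.\<close>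

definition weak_deriv :: "real set \<Rightarrow> (real \<Rightarrow> real) \<Rightarrow> real \<Rightarrow> real" where
  "weak_deriv \<Omega> f = (SOME g. is_weak_deriv \<Omega> f g)"

definition W1p_loc :: "real set \<Rightarrow> real \<Rightarrow> (real \<Rightarrow> real) set" where
  "W1p_loc \<Omega> p = {f \<in> Lp_loc \<Omega> p. \<exists>g \<in> Lp_loc \<Omega> p. is_weak_deriv \<Omega> f g}"

definition Xp :: "real \<Rightarrow> (real \<Rightarrow> real) set" where
  "Xp p = {f \<in> W1p_loc {0<..} p.
     (\<integral>\<^sup>+r. ennreal ((\<bar>weak_deriv {0<..} f r\<bar>\<^sup>2 + (f r)\<^sup>2 / r\<^sup>2) powr (p / 2) * r)
        \<partial>(lebesgue_on {0<..})) < \<infinity>}"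

text \<open>The energy takes the value \<open>\<infinity>\<close> at those elements of \<open>Xp p\<close> whose potential term is not
  integrable.\<close>

definition Ip :: "real \<Rightarrow> (real \<Rightarrow> real) \<Rightarrow> ennreal" where
  "Ip p f = (\<integral>\<^sup>+r. ennreal
     ((((weak_deriv {0<..} f r)\<^sup>2 + (f r)\<^sup>2 / r\<^sup>2) powr (p / 2) + 1 / 2 * (1 - (f r)\<^sup>2)\<^sup>2) * r)
     \<partial>(lebesgue_on {0<..}))"

definition nonneg_minimizer :: "real \<Rightarrow> (real \<Rightarrow> real) \<Rightarrow> bool" where
  "nonneg_minimizer p f \<longleftrightarrow> f \<in> Xp p \<and> (AE r in lebesgue_on {0<..}. 0 \<le> f r) \<and>
     (\<forall>g \<in> Xp p. Ip p f \<le> Ip p g)"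

definition f_inf :: "real \<Rightarrow> real" where
  "f_inf r = (if r < sqrt 2 then r / sqrt 2 else 1)"

definition Linf_norm :: "(real \<Rightarrow> real) \<Rightarrow> ereal" where
  "Linf_norm f = esssup (lebesgue_on {0<..}) (\<lambda>r. ereal \<bar>f r\<bar>)"

end

theory Submission
  imports Defs
begin

text \<open>Write \<open>e = f'\<^sup>2 + f\<^sup>2 / r\<^sup>2\<close>. Three estimates determine a non-negative minimizer \<open>f\<close> up to \<open>ln p / p\<close>
  at the level of \<open>f\<^sup>2\<close>.
  \<^item> Replacing \<open>f\<close> by \<open>min f 1\<close> lowers the energy, so \<open>f \<le> 1\<close>.
  \<^item> Since \<open>\<bar>(f\<^sup>2)'\<bar> \<le> r e\<close> and \<open>e \<le> L + L powr (1 - p / 2) * e powr (p / 2)\<close>, the bound on the energy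
    forces \<open>f\<^sup>2 \<le> L r\<^sup>2 / 2 + O(1 / p)\<close> for \<open>L = exp (12 ln p / p)\<close>.
  \<^item> For the ramp \<open>\<psi> = min (a r) 1\<close> with \<open>2 a\<^sup>2 = 1 / L\<close>, replacing \<open>f\<close> by \<open>max f \<psi>\<close> gains
    \<open>\<integral> (\<psi>\<^sup>2 - f\<^sup>2)\<^sub>+\<^sup>2 r dr / 2\<close> in the potential and costs at most the gradient energy of \<open>\<psi>\<close>, which is
    \<open>O(p powr -3)\<close>. Together with the almost-Lipschitz bound on \<open>f\<^sup>2\<close> this yields \<open>\<psi>\<^sup>2 - f\<^sup>2 = O(1 / p)\<close>
    uniformly.

  A square root then passes from \<open>f\<^sup>2\<close> to \<open>f\<close>. For \<open>p < 4\<close> the bound \<open>0 \<le> f \<le> 1\<close> suffices.\<close>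

section \<open>Functions with vanishing interval integrals\<close>

text \<open>Only minimality against two explicit competitors enters; no Euler-Lagrange equation is
  derived. Both competitors are a \<open>min\<close> or \<open>max\<close>, so what is needed is a
  chain rule for \<open>\<bar>F\<bar>\<close>. This forces the passage from weak derivatives, tested
  against smooth functions and chosen by \<open>SOME\<close>, to locally absolutely continuous
  representatives. The cube in the ramp cost is dictated by the deficit. A deficit \<eta> of
  \<open>F\<^sup>2\<close> below \<open>\<psi>\<^sup>2\<close> at r persists, up to a factor 1/2, as
  long as \<open>t\<^sup>2 - r\<^sup>2\<close> stays below \<eta> / L, because
  \<open>F\<^sup>2\<close> cannot grow faster. The gain in the potential is therefore of order
  \<open>\<eta> ^ 3\<close>, and a cost of order \<open>1 / p ^ 3\<close> yields \<eta> of order 1 /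
  p. The factor 12 in L provides this cost: L powr (1 - p / 2) is at most \<open>1 / p ^ 3\<close>
  once p is at least 4. The price is the lowered slope of the ramp, an error of order ln p / p in
  the squares, which dominates all others. The upper bound integrates the growth estimate from the
  origin. Its starting value comes from the finite gradient energy: the term
  \<open>F\<^sup>2 / r\<^sup>2\<close> forces \<open>F\<^sup>2\<close> to be small at points
  arbitrarily close to 0.\<close>

lemma AE_zero_if_tail_integrals_zero:
  fixes v :: "real \<Rightarrow> real"
  assumes int: "integrable lebesgue v" and zero: "\<And>x. integral {x<..} v = 0"
  shows "AE x in lebesgue. v x = 0"
proof -
  have "v \<in> borel_measurable (completion lborel)" using int by auto
  then obtain w where w[measurable]: "w \<in> borel_measurable lborel" and vw: "AE x in lborel. v x = w x"
    using completion_ex_borel_measurable_real by blast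
  have vw': "AE x in lebesgue. v x = w x" using vw by (rule AE_completion)
  have wi: "integrable lborel w"
  proof -
    have "integrable lebesgue w"
      using int vw' integrable_cong_AE[of v lebesgue w] w
      by (metis borel_measurable_integrable measurable_completion)
    then show ?thesis using integrable_completion[OF w] by simp
  qed
  have tail: "(\<integral>\<^sup>+y. ennreal (w y) * indicator {x<..} y \<partial>lborel)
            = (\<integral>\<^sup>+y. ennreal (- w y) * indicator {x<..} y \<partial>lborel)" for x
  proof -
    have wx: "integrable lborel (\<lambda>y. indicator {x<..} y * w y)"
      using integrable_mult_indicator[OF _ wi, of "{x<..}"] by simp
    have 1: "set_integrable lebesgue {x<..} v"
      unfolding set_integrable_def using integrable_mult_indicator[OF _ int, of "{x<..}"] by simp
    have "0 = integral {x<..} v" using zero by simp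
    also have "\<dots> = (LINT y:{x<..}|lebesgue. v y)"
      using set_lebesgue_integral_eq_integral(2)[OF 1] by simp
    also have "\<dots> = (LINT y:{x<..}|lebesgue. w y)"
      unfolding set_lebesgue_integral_def
      using vw' by (intro integral_cong_AE borel_measurable_scaleR borel_measurable_indicator
          borel_measurable_integrable[OF int] measurable_completion[OF w]) auto
    also have "\<dots> = (\<integral>y. indicator {x<..} y * w y \<partial>lborel)"
      unfolding set_lebesgue_integral_def by (subst integral_completion) auto
    also have "\<dots> = enn2real (\<integral>\<^sup>+y. ennreal (indicator {x<..} y * w y) \<partial>lborel)
       - enn2real (\<integral>\<^sup>+y. ennreal (- (indicator {x<..} y * w y)) \<partial>lborel)"
      by (rule real_lebesgue_integral_def[OF wx])
    finally have "enn2real (\<integral>\<^sup>+y. ennreal (indicator {x<..} y * w y) \<partial>lborel)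
       = enn2real (\<integral>\<^sup>+y. ennreal (- (indicator {x<..} y * w y)) \<partial>lborel)" by simp
    moreover have "(\<integral>\<^sup>+y. ennreal (indicator {x<..} y * w y) \<partial>lborel) \<noteq> \<infinity>"
      "(\<integral>\<^sup>+y. ennreal (- (indicator {x<..} y * w y)) \<partial>lborel) \<noteq> \<infinity>"
      using wx by (auto simp: real_integrable_def)
    ultimately have "(\<integral>\<^sup>+y. ennreal (indicator {x<..} y * w y) \<partial>lborel)
       = (\<integral>\<^sup>+y. ennreal (- (indicator {x<..} y * w y)) \<partial>lborel)"
      by (metis ennreal_enn2real_if infinity_ennreal_def)
    moreover have "ennreal (indicator {x<..} y * w y) = ennreal (w y) * indicator {x<..} y"
      "ennreal (- (indicator {x<..} y * w y)) = ennreal (- w y) * indicator {x<..} y" for y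
      by (auto simp: indicator_def)
    ultimately show ?thesis by simp
  qed
  have fin: "(\<integral>\<^sup>+y. ennreal (w y) \<partial>lborel) < \<infinity>" 
    using wi by (auto simp: real_integrable_def less_top)
  \<comment> \<open>Clipping by \<open>ennreal\<close> makes these the positive and the negative
    part of \<open>w\<close>. Both measures are finite and agree on all rays, hence coincide, and
    uniqueness of densities equates the two parts.\<close>
  have "density lborel (\<lambda>y. ennreal (w y)) = density lborel (\<lambda>y. ennreal (- w y))"
  proof (rule measure_eqI_lessThan)
    fix x
    show "emeasure (density lborel (\<lambda>y. ennreal (w y))) {x<..}
        = emeasure (density lborel (\<lambda>y. ennreal (- w y))) {x<..}"
      using tail[of x] by (simp add: emeasure_density)
    have "(\<integral>\<^sup>+y. ennreal (w y) * indicator {x<..} y \<partial>lborel) \<le> (\<integral>\<^sup>+y. ennreal (w y) \<partial>lborel)"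
      by (intro nn_integral_mono) (auto simp: indicator_def)
    then show "emeasure (density lborel (\<lambda>y. ennreal (w y))) {x<..} < \<infinity>"
      using fin by (simp add: emeasure_density)
  qed auto
  then have "AE y in lborel. ennreal (w y) = ennreal (- w y)"
    by (intro sigma_finite_measure.density_unique[OF sigma_finite_lborel]) auto
  then have "AE y in lborel. w y = 0"
  proof eventually_elim
    case (elim y)
    then show ?case
      by (cases "w y \<ge> 0") (auto simp: ennreal_neg ennreal_eq_0_iff not_le dest: sym)
  qed
  then have "AE y in lebesgue. w y = 0" by (rule AE_completion)
  with vw' show ?thesis by eventually_elim simp
qed

lemma AE_lebesgue_on_iff:
  assumes "S \<in> sets lebesgue"
  shows "(AE x in lebesgue_on S. P x) \<longleftrightarrow> (AE x in lebesgue. x \<in> S \<longrightarrow> P x)"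
  by (subst AE_restrict_space_iff) (use assms in auto)

lemma AE_Ioi_if_AE_Icc:
  assumes "\<And>a b::real. 0 < a \<Longrightarrow> a \<le> b \<Longrightarrow> AE x in lebesgue. x \<in> {a..b} \<longrightarrow> P x"
  shows "AE x in lebesgue_on {0<..}. P x"
proof -
  have "AE x in lebesgue. x \<in> {inverse (real (Suc n))..real (Suc n)} \<longrightarrow> P x" for n
    by (rule assms) (auto simp: field_simps)
  then have "AE x in lebesgue. \<forall>n. x \<in> {inverse (real (Suc n))..real (Suc n)} \<longrightarrow> P x"
    by (subst AE_all_countable) auto
  then have "AE x in lebesgue. x \<in> {0<..} \<longrightarrow> P x"
  proof eventually_elim
    case (elim x)
    show ?case
    proof
      assume x: "x \<in> {0<..}"
      obtain n where n: "inverse (real (Suc n)) < x" using reals_Archimedean[of x] x by auto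
      obtain m where m: "x < real m" using reals_Archimedean2 by blast
      have "inverse (real (Suc (max m n))) \<le> inverse (real (Suc n))"
        by (simp add: field_simps)
      with n have "inverse (real (Suc (max m n))) \<le> x" by linarith
      moreover have "x \<le> real (Suc (max m n))" using m by simp
      ultimately have "x \<in> {inverse (real (Suc (max m n)))..real (Suc (max m n))}"
        by (simp only: atLeastAtMost_iff simp_thms)
      with elim show "P x" by blast
    qed
  qed
  then show ?thesis by (subst AE_lebesgue_on_iff) auto
qed

text \<open>Cutting \<open>u\<close> off outside \<open>{a..b}\<close> turns each tail integral into
  an integral over a subinterval, up to a single point.\<close>

lemma AE_zero_if_interval_integrals_zero:
  fixes u :: "real \<Rightarrow> real"
  assumes int: "\<And>a b. 0 < a \<Longrightarrow> a \<le> b \<Longrightarrow> u absolutely_integrable_on {a..b}"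
    and zero: "\<And>a b. 0 < a \<Longrightarrow> a < b \<Longrightarrow> integral {a..b} u = 0"
  shows "AE x in lebesgue_on {0<..}. u x = 0"
proof (rule AE_Ioi_if_AE_Icc)
  fix a b :: real assume ab: "0 < a" "a \<le> b"
  define v where "v x = (if x \<in> {a..b} then u x else 0)" for x
  have "v absolutely_integrable_on UNIV"
    unfolding v_def absolutely_integrable_restrict_UNIV using int ab by auto
  then have "integrable lebesgue v" by (simp add: set_integrable_def)
  moreover have "integral {x<..} v = 0" for x
  proof -
    have "integral {x<..} v = integral ({x<..} \<inter> {a..b}) u"
      unfolding v_def by (subst integral_restrict_Int) (simp add: Int_commute)
    also have "\<dots> = integral {max a x..b} u"
    proof (rule integral_spike_set)
      show "negligible {y \<in> {x<..} \<inter> {a..b} - {max a x..b}. u y \<noteq> 0}"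
        by (rule negligible_subset[of "{}"]) auto
      show "negligible {y \<in> {max a x..b} - {x<..} \<inter> {a..b}. u y \<noteq> 0}"
        by (rule negligible_subset[of "{x}"]) auto
    qed
    also have "\<dots> = 0"
      using zero[of "max a x" b] ab by (cases "max a x" b rule: linorder_cases) auto
    finally show ?thesis .
  qed
  ultimately have "AE x in lebesgue. v x = 0" by (rule AE_zero_if_tail_integrals_zero)
  then show "AE x in lebesgue. x \<in> {a..b} \<longrightarrow> u x = 0"
    by eventually_elim (auto simp: v_def)
qed

section \<open>Locally absolutely continuous functions on the half-line\<close>

text \<open>Local absolute continuity, encoded by the fundamental theorem of calculus instead of
  \<epsilon>-\<delta>. The derivative \<open>g\<close> is carried along explicitly and matters only
  up to a null set, so that \<open>F\<close> need not be differentiated pointwise.\<close>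

definition loc_ac :: "(real \<Rightarrow> real) \<Rightarrow> (real \<Rightarrow> real) \<Rightarrow> bool" where
  "loc_ac F g \<longleftrightarrow> (\<forall>a b. 0 < a \<longrightarrow> a \<le> b \<longrightarrow>
     g absolutely_integrable_on {a..b} \<and> (g has_integral (F b - F a)) {a..b})"

lemma loc_acD:
  assumes "loc_ac F g" "0 < a" "a \<le> b"
  shows "g absolutely_integrable_on {a..b}" "(g has_integral (F b - F a)) {a..b}"
    "g integrable_on {a..b}" "integral {a..b} g = F b - F a"
    "(\<lambda>x. \<bar>g x\<bar>) integrable_on {a..b}"
proof -
  show 1: "g absolutely_integrable_on {a..b}" and 2: "(g has_integral (F b - F a)) {a..b}"
    using assms by (auto simp: loc_ac_def)
  show "g integrable_on {a..b}" "integral {a..b} g = F b - F a"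
    using 2 by (auto simp: has_integral_integrable integral_unique)
  show "(\<lambda>x. \<bar>g x\<bar>) integrable_on {a..b}" using 1 by (simp add: absolutely_integrable_on_def)
qed

lemma loc_ac_cong:
  assumes "loc_ac F g" "\<And>x. 0 < x \<Longrightarrow> F x = F' x" "\<And>x. 0 < x \<Longrightarrow> g x = g' x"
  shows "loc_ac F' g'"
  unfolding loc_ac_def
proof (intro allI impI conjI)
  fix a b :: real assume ab: "0 < a" "a \<le> b"
  show "g' absolutely_integrable_on {a..b}"
    using loc_acD(1)[OF assms(1) ab] assms(3) ab
    by (subst set_integrable_cong[of _ lebesgue _ _ _ g]) auto
  show "(g' has_integral (F' b - F' a)) {a..b}"
    using loc_acD(2)[OF assms(1) ab] assms(2)[of a] assms(2)[of b] assms(3) ab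
    by (subst has_integral_cong[of _ _ g]) auto
qed

lemma loc_ac_continuous:
  assumes "loc_ac F g"
  shows "continuous_on {0<..} F"
proof (rule continuous_at_imp_continuous_on, rule ballI)
    fix x :: real assume x: "x \<in> {0<..}"
    have "continuous_on {x/2..2*x} (\<lambda>y. F (x/2) + integral {x/2..y} g)"
      using loc_acD(3)[OF assms, of "x/2" "2*x"] x
      by (intro continuous_intros indefinite_integral_continuous_1) auto
    moreover have "F (x/2) + integral {x/2..y} g = F y" if "y \<in> {x/2..2*x}" for y
      using loc_acD(4)[OF assms, of "x/2" y] x that by auto
    ultimately have "continuous_on {x/2..2*x} F" by (rule continuous_on_eq)
    then show "isCont F x"
      by (rule continuous_on_interior) (use x in \<open>auto simp: interior_atLeastAtMost_real\<close>)
qed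

text \<open>The defect \<open>Q\<close> is additive over adjacent intervals and, by continuity of
  \<open>H' (F x)\<close>, bounded by \<open>e * \<integral>\<bar>g\<bar>\<close> on short ones.
  Bisection carries this bound to \<open>{a..b}\<close>, and \<open>e\<close> is arbitrary.\<close>

lemma loc_ac_chain:
  assumes F: "loc_ac F g" and H: "\<And>x. (H has_real_derivative H' x) (at x)"
    and H': "continuous_on UNIV H'"
  shows "loc_ac (\<lambda>x. H (F x)) (\<lambda>x. H' (F x) * g x)"
  unfolding loc_ac_def
proof (intro allI impI)
  fix a b :: real assume a: "0 < a" and ab: "a \<le> b"
  define K where "K x = H' (F x)" for x
  have contF: "continuous_on {a..b} F"
    using loc_ac_continuous[OF F] by (rule continuous_on_subset) (use a in auto)
  have contK: "continuous_on {a..b} K"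
    unfolding K_def by (rule continuous_on_compose2[OF H' contF]) auto
  have abs: "(\<lambda>x. K x * g x) absolutely_integrable_on {a..b}"
  proof (rule absolutely_integrable_bounded_measurable_product_real)
    show "K \<in> borel_measurable (lebesgue_on {a..b})"
      by (rule continuous_imp_measurable_on_sets_lebesgue[OF contK]) auto
    show "bounded (K ` {a..b})"
      by (intro compact_imp_bounded compact_continuous_image contK) auto
    show "g absolutely_integrable_on {a..b}" using loc_acD(1)[OF F a ab] .
  qed auto
  have int: "(\<lambda>x. K x * g x) integrable_on {x..y}" if "a \<le> x" "y \<le> b" for x y
    using absolutely_integrable_on_subinterval[OF abs, of x y] that
    by (auto simp: absolutely_integrable_on_def)
  have gint: "g integrable_on {x..y}" "(\<lambda>x. \<bar>g x\<bar>) integrable_on {x..y}"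
    if "a \<le> x" "y \<le> b" for x y
    using absolutely_integrable_on_subinterval[OF loc_acD(1)[OF F a ab], of x y] that
    by (auto simp: absolutely_integrable_on_def)
  define Q where "Q x y = H (F y) - H (F x) - integral {x..y} (\<lambda>x. K x * g x)" for x y
  have bound: "\<bar>Q a b\<bar> \<le> e * integral {a..b} (\<lambda>x. \<bar>g x\<bar>)" if e: "e > 0" for e
  proof -
    \<comment> \<open>The guards make the claim vacuous for the short intervals around a point that
      stick out of \<open>{a..b}\<close>.\<close>
    define P where "P x y \<longleftrightarrow> (a \<le> x \<longrightarrow> y \<le> b \<longrightarrow> \<bar>Q x y\<bar> \<le> e * integral {x..y} (\<lambda>x. \<bar>g x\<bar>))" for x y
    have "P a b"
    proof (induction rule: Bolzano[OF ab])
      case (1 x y z)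
      show ?case unfolding P_def
      proof (intro impI)
        assume xz: "a \<le> x" "z \<le> b"
        have "Q x z = Q x y + Q y z"
          using Henstock_Kurzweil_Integration.integral_combine[OF 1(3,4) int[OF xz]]
          by (simp add: Q_def)
        moreover have "integral {x..z} (\<lambda>x. \<bar>g x\<bar>) = integral {x..y} (\<lambda>x. \<bar>g x\<bar>) + integral {y..z} (\<lambda>x. \<bar>g x\<bar>)"
          using Henstock_Kurzweil_Integration.integral_combine[OF 1(3,4) gint(2)[OF xz]] by simp
        ultimately show "\<bar>Q x z\<bar> \<le> e * integral {x..z} (\<lambda>x. \<bar>g x\<bar>)"
          using 1 xz by (auto simp: P_def algebra_simps)
      qed
    next
      case (2 x)
      then have "x \<in> {a..b}" by auto
      then obtain d where d: "d > 0" and dK: "\<And>t. t \<in> {a..b} \<Longrightarrow> dist t x < d \<Longrightarrow> dist (K t) (K x) < e/2"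
        using contK[unfolded continuous_on_iff] e by (metis half_gt_zero)
      have "P u v" if uv: "u \<le> x" "x \<le> v" "v - u < d" for u v
        unfolding P_def
      proof (intro impI)
        assume u: "a \<le> u" and v: "v \<le> b"
        have contuv: "continuous_on {u..v} F" using contF by (rule continuous_on_subset) (use u v in auto)
        have FI: "integral {u..v} g = F v - F u" using loc_acD(4)[OF F, of u v] u a uv by auto
        \<comment> \<open>The mean value theorem for \<open>H\<close> gives a point between
          \<open>F u\<close> and \<open>F v\<close>; by the intermediate value theorem it is a value
          \<open>F t\<close>, so that \<open>H'\<close> is evaluated along \<open>F\<close>.\<close>
        have "\<exists>t\<in>{u..v}. H (F v) - H (F u) = K t * (F v - F u)"
        proof (cases "F u" "F v" rule: linorder_cases)
          case less
          then obtain z where z: "F u < z" "z < F v" "H (F v) - H (F u) = (F v - F u) * H' z"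
            using MVT2[of "F u" "F v" H H'] H by auto
          then obtain t where "u \<le> t" "t \<le> v" "F t = z"
            using IVT'[of F u z v] contuv uv by auto
          with z show ?thesis by (auto simp: K_def)
        next
          case equal then show ?thesis using uv by auto
        next
          case greater
          then obtain z where z: "F v < z" "z < F u" "H (F u) - H (F v) = (F u - F v) * H' z"
            using MVT2[of "F v" "F u" H H'] H by auto
          then obtain t where "u \<le> t" "t \<le> v" "F t = z"
            using IVT2'[of F v z u] contuv uv by auto
          with z show ?thesis by (intro bexI[of _ t]) (auto simp: K_def algebra_simps)
        qed
        then obtain t where t: "t \<in> {u..v}" "H (F v) - H (F u) = K t * (F v - F u)" by auto
        have "Q u v = integral {u..v} (\<lambda>s. K t * g s) - integral {u..v} (\<lambda>s. K s * g s)"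
          by (simp add: Q_def t(2) FI)
        also have "\<dots> = integral {u..v} (\<lambda>s. K t * g s - K s * g s)"
          by (rule integral_diff[symmetric]) (intro integrable_on_mult_right gint int u v)+
        finally have "\<bar>Q u v\<bar> = norm (integral {u..v} (\<lambda>s. K t * g s - K s * g s))" by simp
        also have "\<dots> \<le> integral {u..v} (\<lambda>s. e * \<bar>g s\<bar>)"
        proof (rule integral_norm_bound_integral)
          show "(\<lambda>s. K t * g s - K s * g s) integrable_on {u..v}"
            by (intro integrable_diff integrable_on_mult_right gint int u v)
          show "(\<lambda>s. e * \<bar>g s\<bar>) integrable_on {u..v}" by (intro integrable_on_mult_right gint u v)
          fix s assume s: "s \<in> {u..v}"
          have "dist (K t) (K x) < e/2" "dist (K s) (K x) < e/2"
            using dK[of t] dK[of s] s t u v uv by (auto simp: dist_real_def)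
          then have "\<bar>K t - K s\<bar> \<le> e" unfolding dist_real_def by linarith
          then have "\<bar>K t - K s\<bar> * \<bar>g s\<bar> \<le> e * \<bar>g s\<bar>" by (rule mult_right_mono) auto
          then show "norm (K t * g s - K s * g s) \<le> e * \<bar>g s\<bar>"
            by (simp add: abs_mult[symmetric] algebra_simps)
        qed
        finally show "\<bar>Q u v\<bar> \<le> e * integral {u..v} (\<lambda>x. \<bar>g x\<bar>)" by simp
      qed
      with d show ?case by auto
    qed
    then show ?thesis by (auto simp: P_def)
  qed
  have "Q a b = 0"
  proof (rule ccontr)
    assume Q: "Q a b \<noteq> 0"
    define c where "c = integral {a..b} (\<lambda>x. \<bar>g x\<bar>)"
    have c: "c \<ge> 0" unfolding c_def by (rule integral_nonneg[OF gint(2)]) auto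
    have "\<bar>Q a b\<bar> \<le> \<bar>Q a b\<bar> / (c + 1) * c"
      using bound[of "\<bar>Q a b\<bar> / (c + 1)"] Q c by (simp add: c_def)
    then have "\<bar>Q a b\<bar> * (c + 1) \<le> \<bar>Q a b\<bar> * c" using c by (simp add: field_simps)
    then show False using Q by (simp add: algebra_simps)
  qed
  then show "(\<lambda>x. H' (F x) * g x) absolutely_integrable_on {a..b} \<and>
           ((\<lambda>x. H' (F x) * g x) has_integral H (F b) - H (F a)) {a..b}"
    using abs int[of a b] by (auto simp: Q_def K_def has_integral_integrable_integral)
qed

lemma loc_ac_C1:
  assumes "\<And>x. 0 < x \<Longrightarrow> (F has_real_derivative f x) (at x)" "continuous_on {0<..} f"
  shows "loc_ac F f"
  unfolding loc_ac_def
proof (intro allI impI conjI)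
  fix a b :: real assume ab: "0 < a" "a \<le> b"
  show "f absolutely_integrable_on {a..b}"
    by (rule absolutely_integrable_continuous_real)
      (rule continuous_on_subset[OF assms(2)], use ab in auto)
  show "(f has_integral F b - F a) {a..b}"
    by (rule fundamental_theorem_of_calculus)
      (use assms(1) ab in \<open>auto simp: has_real_derivative_iff_has_vector_derivative[symmetric] intro: has_field_derivative_at_within\<close>)
qed

lemma loc_ac_const: "loc_ac (\<lambda>x. c) (\<lambda>x. 0)"
  by (auto simp: loc_ac_def)

lemma loc_ac_add:
  assumes "loc_ac F f" "loc_ac G g"
  shows "loc_ac (\<lambda>x. F x + G x) (\<lambda>x. f x + g x)"
  unfolding loc_ac_def
proof (intro allI impI conjI)
  fix a b :: real assume ab: "0 < a" "a \<le> b"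
  show "(\<lambda>x. f x + g x) absolutely_integrable_on {a..b}"
    using loc_acD(1)[OF assms(1) ab] loc_acD(1)[OF assms(2) ab] by (rule set_integral_add)
  show "((\<lambda>x. f x + g x) has_integral F b + G b - (F a + G a)) {a..b}"
    using has_integral_add[OF loc_acD(2)[OF assms(1) ab] loc_acD(2)[OF assms(2) ab]]
    by (simp add: algebra_simps)
qed

lemma loc_ac_cmult:
  assumes "loc_ac F f"
  shows "loc_ac (\<lambda>x. c * F x) (\<lambda>x. c * f x)"
  using loc_ac_chain[OF assms, of "\<lambda>x. c * x" "\<lambda>x. c"] by (auto intro!: derivative_eq_intros)

lemma loc_ac_diff:
  assumes "loc_ac F f" "loc_ac G g"
  shows "loc_ac (\<lambda>x. F x - G x) (\<lambda>x. f x - g x)"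
  using loc_ac_add[OF assms(1) loc_ac_cmult[OF assms(2), of "-1"]] by simp

lemma loc_ac_square:
  assumes "loc_ac F f"
  shows "loc_ac (\<lambda>x. (F x)\<^sup>2) (\<lambda>x. 2 * F x * f x)"
proof (rule loc_ac_chain[OF assms, of "\<lambda>x. x\<^sup>2" "\<lambda>x. 2 * x"])
  show "((\<lambda>x. x\<^sup>2) has_real_derivative 2 * x) (at x)" for x :: real
    by (auto intro!: derivative_eq_intros)
qed (intro continuous_intros)

text \<open>Polarization: twice the product is the square of the sum minus both squares, so the
  chain rule for squares suffices.\<close>

lemma loc_ac_mult:
  assumes "loc_ac F f" "loc_ac G g"
  shows "loc_ac (\<lambda>x. F x * G x) (\<lambda>x. f x * G x + F x * g x)"
  using loc_ac_cmult[OF loc_ac_diff[OF loc_ac_diff[OF loc_ac_square[OF loc_ac_add[OF assms]]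
        loc_ac_square[OF assms(1)]] loc_ac_square[OF assms(2)]], of "1/2"]
  by (rule loc_ac_cong) (auto simp: power2_eq_square algebra_simps)

text \<open>The chain rule applies to the smooth approximations
  \<open>sqrt (x\<^sup>2 + e n)\<close> of the absolute value. Their derivatives are bounded by 1,
  and dominated convergence passes to the limit.\<close>

lemma loc_ac_abs:
  assumes F: "loc_ac F f"
  shows "loc_ac (\<lambda>x. \<bar>F x\<bar>) (\<lambda>x. sgn (F x) * f x)"
  unfolding loc_ac_def
proof (intro allI impI)
  fix a b :: real assume ab: "0 < a" "a \<le> b"
  define e where "e n = inverse (real (Suc n))" for n
  define H where "H n x = sqrt (x\<^sup>2 + e n)" for n and x :: real
  define H' where "H' n x = x / sqrt (x\<^sup>2 + e n)" for n and x :: real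
  have e: "e n > 0" for n by (simp add: e_def)
  have pos: "x\<^sup>2 + e n > 0" for n and x :: real using e[of n] by (simp add: add_nonneg_pos)
  have elim: "e \<longlonglongrightarrow> 0" unfolding e_def by (rule LIMSEQ_inverse_real_of_nat)
  have acH: "loc_ac (\<lambda>x. H n (F x)) (\<lambda>x. H' n (F x) * f x)" for n
  proof (rule loc_ac_chain[OF F])
    show "(H n has_real_derivative H' n x) (at x)" for x
      unfolding H_def H'_def using pos[of x n]
      by (auto intro!: derivative_eq_intros simp: field_simps)
    show "continuous_on UNIV (H' n)"
      unfolding H'_def using pos[of _ n] by (intro continuous_intros ballI) (simp add: less_imp_neq[symmetric])
  qed
  have Hlim: "(\<lambda>n. H n x) \<longlonglongrightarrow> \<bar>x\<bar>" for x
  proof -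
    have "(\<lambda>n. H n x) \<longlonglongrightarrow> sqrt (x\<^sup>2 + 0)" unfolding H_def by (intro tendsto_intros elim)
    then show ?thesis by simp
  qed
  \<comment> \<open>At \<open>x = 0\<close> every \<open>H' n x\<close> vanishes, as does
    \<open>sgn x\<close>, so convergence holds everywhere and the zero set of \<open>F\<close> needs
    no separate treatment.\<close>
  have H'lim: "(\<lambda>n. H' n x) \<longlonglongrightarrow> sgn x" for x
  proof (cases "x = 0")
    case False
    have "(\<lambda>n. H' n x) \<longlonglongrightarrow> x / sqrt (x\<^sup>2 + 0)" unfolding H'_def
      using False by (intro tendsto_intros elim) auto
    moreover have "x / sqrt (x\<^sup>2 + 0) = sgn x" using False by (simp add: sgn_real_def abs_if)
    ultimately show ?thesis by simp
  qed (simp add: H'_def)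
  have H'le: "\<bar>H' n x\<bar> \<le> 1" for n x
  proof -
    have "\<bar>x\<bar> \<le> sqrt (x\<^sup>2 + e n)"
      using e[of n] by (metis add_increasing2 less_imp_le order_refl real_sqrt_abs real_sqrt_le_iff)
    then show ?thesis using pos[of x n] by (simp add: H'_def)
  qed
  have dom: "norm (H' n (F x) * f x) \<le> \<bar>f x\<bar>" for n x
    using mult_right_mono[OF H'le[of n "F x"], of "\<bar>f x\<bar>"] by (simp add: abs_mult)
  note int = loc_acD(5)[OF F ab]
  have lim: "(\<lambda>n. H' n (F x) * f x) \<longlonglongrightarrow> sgn (F x) * f x" for x
    by (intro tendsto_intros H'lim)
  have "(\<lambda>n. integral {a..b} (\<lambda>x. H' n (F x) * f x)) \<longlonglongrightarrow> integral {a..b} (\<lambda>x. sgn (F x) * f x)"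
    by (rule dominated_convergence(2)[OF loc_acD(3)[OF acH ab] int dom lim])
  moreover have "(\<lambda>n. integral {a..b} (\<lambda>x. H' n (F x) * f x)) \<longlonglongrightarrow> \<bar>F b\<bar> - \<bar>F a\<bar>"
    unfolding loc_acD(4)[OF acH ab] by (intro tendsto_intros Hlim)
  ultimately have eq: "integral {a..b} (\<lambda>x. sgn (F x) * f x) = \<bar>F b\<bar> - \<bar>F a\<bar>"
    by (rule LIMSEQ_unique)
  have "(\<lambda>x. sgn (F x) * f x) absolutely_integrable_on {a..b}"
    by (rule dominated_convergence_absolutely_integrable[OF loc_acD(1)[OF acH ab] int _ lim])
      (auto simp: abs_mult abs_sgn_eq)
  then show "(\<lambda>x. sgn (F x) * f x) absolutely_integrable_on {a..b} \<and>
           ((\<lambda>x. sgn (F x) * f x) has_integral \<bar>F b\<bar> - \<bar>F a\<bar>) {a..b}"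
    using eq by (auto simp: has_integral_integrable_integral absolutely_integrable_on_def)
qed

text \<open>Half of the sum plus half of the absolute difference. Where both functions agree,
  \<open>sgn 0 = 0\<close> leaves the average of the derivatives, hence the third branch.\<close>

lemma loc_ac_max:
  assumes "loc_ac F f" "loc_ac G g"
  shows "loc_ac (\<lambda>x. max (F x) (G x))
    (\<lambda>x. if F x < G x then g x else if G x < F x then f x else (f x + g x) / 2)"
  using loc_ac_cmult[OF loc_ac_add[OF loc_ac_add[OF assms] loc_ac_abs[OF loc_ac_diff[OF assms]]], of "1/2"]
  by (rule loc_ac_cong) (auto simp: max_def sgn_real_def)

lemma loc_ac_min:
  assumes "loc_ac F f" "loc_ac G g"
  shows "loc_ac (\<lambda>x. min (F x) (G x))
    (\<lambda>x. if F x < G x then f x else if G x < F x then g x else (f x + g x) / 2)"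
  using loc_ac_cmult[OF loc_ac_diff[OF loc_ac_add[OF assms] loc_ac_abs[OF loc_ac_diff[OF assms]]], of "1/2"]
  by (rule loc_ac_cong) (auto simp: min_def sgn_real_def)

section \<open>Smooth step functions\<close>

definition smooth :: "(real \<Rightarrow> real) \<Rightarrow> bool" where
  "smooth f \<longleftrightarrow> (\<forall>n x. (deriv ^^ n) f differentiable (at x))"

lemma smooth_imp_differentiable: "smooth f \<Longrightarrow> f differentiable (at x)"
  unfolding smooth_def by (metis funpow_0)

lemma smooth_deriv: "smooth f \<Longrightarrow> smooth (deriv f)"
  unfolding smooth_def by (metis funpow_Suc_right o_apply)

lemma smooth_DERIV: "smooth f \<Longrightarrow> (f has_real_derivative deriv f x) (at x)"
  using smooth_imp_differentiable by (metis DERIV_deriv_iff_real_differentiable)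

text \<open>The set \<open>A\<close> serves as an invariant for iterated differentiation; applying
  the rule means finding a family that contains the function and is closed under
  \<open>deriv\<close>.\<close>

lemma smooth_coinduct:
  assumes "f \<in> A" "\<And>f x. f \<in> A \<Longrightarrow> f differentiable (at x)" "\<And>f. f \<in> A \<Longrightarrow> deriv f \<in> A"
  shows "smooth f"
proof -
  have "(deriv ^^ n) f \<in> A" for n by (induction n) (use assms in auto)
  then show ?thesis using assms(2) by (auto simp: smooth_def)
qed

lemma smooth_if_deriv:
  assumes "\<And>x. (f has_real_derivative f' x) (at x)" "smooth f'"
  shows "smooth f"
proof -
  have d: "deriv f = f'" using assms(1) by (auto intro!: DERIV_imp_deriv)
  have "(deriv ^^ n) f differentiable (at x)" for n x
  proof (cases n)
    case 0 then show ?thesis using assms(1) by (auto simp: real_differentiable_def)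
  next
    case (Suc m) 
    then have "(deriv ^^ n) f = (deriv ^^ m) f'" using d by (simp add: funpow_swap1)
    then show ?thesis using assms(2) by (simp add: smooth_def)
  qed
  then show ?thesis by (simp add: smooth_def)
qed

text \<open>By the Leibniz rule products of smooth functions leave the set of products when
  differentiated, whereas finite sums of products form a closed family.\<close>

inductive_set smooth_sums :: "(real \<Rightarrow> real) set" where
  prod: "smooth f \<Longrightarrow> smooth g \<Longrightarrow> (\<lambda>x. f x * g x) \<in> smooth_sums"
| add: "f \<in> smooth_sums \<Longrightarrow> g \<in> smooth_sums \<Longrightarrow> (\<lambda>x. f x + g x) \<in> smooth_sums"

lemma smooth_smooth_sums:
  assumes "f \<in> smooth_sums" shows "smooth f"
proof -
  have *: "\<exists>f'. f' \<in> smooth_sums \<and> (\<forall>x. (f has_real_derivative f' x) (at x))" if "f \<in> smooth_sums" for f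
    using that
  proof induction
    case (prod f g)
    have "(\<lambda>x. deriv f x * g x + f x * deriv g x) \<in> smooth_sums"
      by (rule smooth_sums.add) (rule smooth_sums.prod, intro smooth_deriv prod, intro smooth_deriv prod)+
    moreover have "((\<lambda>x. f x * g x) has_real_derivative deriv f x * g x + f x * deriv g x) (at x)" for x
      using smooth_DERIV[OF prod(1), of x] smooth_DERIV[OF prod(2), of x]
      by (auto intro!: derivative_eq_intros)
    ultimately show ?case by blast
  next
    case (add f g)
    then obtain f' g' where "f' \<in> smooth_sums" "g' \<in> smooth_sums"
      "\<And>x. (f has_real_derivative f' x) (at x)" "\<And>x. (g has_real_derivative g' x) (at x)" by blast
    then have "(\<lambda>x. f' x + g' x) \<in> smooth_sums \<and> 
       (\<forall>x. ((\<lambda>x. f x + g x) has_real_derivative f' x + g' x) (at x))"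
      by (auto intro!: smooth_sums.intros derivative_eq_intros)
    then show ?case by blast
  qed
  show ?thesis
  proof (rule smooth_coinduct[OF assms])
    fix f assume "f \<in> smooth_sums"
    with * obtain f' where f': "f' \<in> smooth_sums" "\<And>x. (f has_real_derivative f' x) (at x)" by blast
    then show "f differentiable (at x)" for x by (auto simp: real_differentiable_def)
    have "deriv f = f'" using f' by (auto intro!: DERIV_imp_deriv)
    then show "deriv f \<in> smooth_sums" using f' by simp
  qed
qed

lemma smooth_const [intro]: "smooth (\<lambda>x. c)"
  by (rule smooth_coinduct[of _ "range (\<lambda>c x. c)"]) (auto)

lemma smooth_mult: "smooth f \<Longrightarrow> smooth g \<Longrightarrow> smooth (\<lambda>x. f x * g x)"
  by (rule smooth_smooth_sums[OF smooth_sums.prod])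

lemma smooth_add: "smooth f \<Longrightarrow> smooth g \<Longrightarrow> smooth (\<lambda>x. f x + g x)"
  using smooth_smooth_sums[OF smooth_sums.add[OF smooth_sums.prod[of f "\<lambda>x. 1"] smooth_sums.prod[of g "\<lambda>x. 1"]]]
  by auto

lemma smooth_diff: "smooth f \<Longrightarrow> smooth g \<Longrightarrow> smooth (\<lambda>x. f x - g x)"
  using smooth_add[of f "\<lambda>x. (-1) * g x"] smooth_mult[of "\<lambda>x. -1" g] by auto

lemma smooth_affine:
  assumes "smooth f" shows "smooth (\<lambda>x. f (c * x + d))"
\<comment> \<open>The free factor \<open>k\<close> absorbs the powers of \<open>c\<close> coming
  from the inner derivative.\<close>
proof (rule smooth_coinduct[of _ "{\<lambda>x. k * f (c * x + d) | k f. smooth f}"])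
  show "(\<lambda>x. f (c * x + d)) \<in> {\<lambda>x. k * f (c * x + d) | k f. smooth f}"
    using assms by (auto intro!: exI[of _ 1])
  fix g assume "g \<in> {\<lambda>x. k * f (c * x + d) | k f. smooth f}"
  then obtain k f where g: "g = (\<lambda>x. k * f (c * x + d))" and f: "smooth f" by blast
  have D: "(g has_real_derivative (k * c) * deriv f (c * x + d)) (at x)" for x
    unfolding g by (auto intro!: derivative_eq_intros DERIV_chain'[OF _ smooth_DERIV[OF f]])
  then show "g differentiable (at x)" for x by (auto simp: real_differentiable_def)
  have "deriv g = (\<lambda>x. (k * c) * deriv f (c * x + d))" using D by (auto intro!: DERIV_imp_deriv)
  then show "deriv g \<in> {\<lambda>x. k * f (c * x + d) | k f. smooth f}"
    using smooth_deriv[OF f] by blast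
qed

text \<open>The classical flat function, for \<open>q = 1\<close>. The polynomial parameter makes
  the family closed under differentiation: with y = 1 / x the derivative multiplies by
  \<open>- y\<^sup>2\<close> and replaces q by q' - q.\<close>

definition exp_inv :: "real poly \<Rightarrow> real \<Rightarrow> real" where
  "exp_inv q x = (if x \<le> 0 then 0 else poly q (inverse x) * exp (- inverse x))"

lemma poly_exp_neg_tendsto_0:
  "((\<lambda>y. poly q y * exp (- y)) \<longlongrightarrow> 0) (at_top :: real filter)"
proof -
  have "((\<lambda>y. \<Sum>i\<le>degree q. coeff q i * (y ^ i / exp y)) \<longlongrightarrow> (\<Sum>i\<le>degree q. coeff q i * 0)) at_top"
    by (intro tendsto_intros tendsto_power_div_exp_0)
  then show ?thesis
    by (simp add: poly_altdef exp_minus divide_inverse sum_distrib_right mult.assoc)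
qed

lemma exp_inv_DERIV:
  "(exp_inv q has_real_derivative exp_inv (monom 1 2 * (q - pderiv q)) x) (at x)"
proof -
  consider "x > 0" | "x < 0" | "x = 0" by linarith
  then show ?thesis
  proof cases
    case 1
    have "((\<lambda>x. poly q (inverse x) * exp (- inverse x)) has_real_derivative
       exp_inv (monom 1 2 * (q - pderiv q)) x) (at x)"
      using 1 by (auto intro!: derivative_eq_intros DERIV_chain'[OF _ poly_DERIV]
        simp: exp_inv_def poly_monom field_simps power2_eq_square)
    moreover have "eventually (\<lambda>y. exp_inv q y = poly q (inverse y) * exp (- inverse y)) (nhds x)"
      using eventually_nhds_in_open[of "{0<..}" x] 1 by (auto elim!: eventually_mono simp: exp_inv_def)
    ultimately show ?thesis by (subst DERIV_cong_ev[OF refl _ refl]) auto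
  next
    case 2
    have "eventually (\<lambda>y. exp_inv q y = 0) (nhds x)"
      using eventually_nhds_in_open[of "{..<0}" x] 2 by (auto elim!: eventually_mono simp: exp_inv_def)
    then show ?thesis using 2 by (subst DERIV_cong_ev[OF refl _ refl]) (auto simp: exp_inv_def)
  next
    case 3
    \<comment> \<open>With y = 1 / h the difference quotient at 0 is
      \<open>y * poly q y * exp (- y)\<close>, and the exponential wins as y grows.\<close>
    have right: "((\<lambda>h. exp_inv q h / h) \<longlongrightarrow> 0) (at_right 0)"
    proof -
      have "((\<lambda>h. poly (monom 1 1 * q) (inverse h) * exp (- inverse h)) \<longlongrightarrow> 0) (at_right (0::real))"
        by (rule filterlim_compose[OF poly_exp_neg_tendsto_0 filterlim_inverse_at_top_right])
      moreover have "eventually (\<lambda>h. poly (monom 1 1 * q) (inverse h) * exp (- inverse h) = exp_inv q h / h) (at_right 0)"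
        by (auto simp: eventually_at_filter exp_inv_def poly_monom field_simps)
      ultimately show ?thesis by (rule Lim_transform_eventually)
    qed
    have left: "((\<lambda>h. exp_inv q h / h) \<longlongrightarrow> 0) (at_left 0)"
      by (rule Lim_transform_eventually[OF tendsto_const])
        (auto simp: eventually_at_filter exp_inv_def)
    have "((\<lambda>h. exp_inv q h / h) \<longlongrightarrow> 0) (at 0)"
      using left right by (simp add: filterlim_split_at)
    then show ?thesis using 3 by (simp add: DERIV_def exp_inv_def)
  qed
qed

lemma smooth_exp_inv: "smooth (exp_inv q)"
proof (rule smooth_coinduct[of _ "range exp_inv"])
  fix f assume "f \<in> range exp_inv"
  then obtain q where f: "f = exp_inv q" by auto
  show "f differentiable (at x)" for x using exp_inv_DERIV f by (auto simp: real_differentiable_def)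
  have "deriv f = exp_inv (monom 1 2 * (q - pderiv q))" 
    unfolding f by (intro ext DERIV_imp_deriv exp_inv_DERIV)
  then show "deriv f \<in> range exp_inv" by auto
qed auto

lemma DERIV_zero_const_on:
  fixes f :: "real \<Rightarrow> real"
  assumes "\<And>x. a \<le> x \<Longrightarrow> x \<le> b \<Longrightarrow> (f has_real_derivative 0) (at x)" "a \<le> b"
  shows "f a = f b"
proof (cases "a = b")
  case False
  have "continuous_on {a..b} f"
    using assms(1) by (intro continuous_at_imp_continuous_on ballI) (auto intro: DERIV_isCont)
  then show ?thesis using DERIV_isconst_end[of a b f] assms False by auto
qed simp

lemma continuous_antiderivative:
  fixes f :: "real \<Rightarrow> real"
  assumes "continuous_on UNIV f"
  obtains F where "\<And>x. (F has_real_derivative f x) (at x)"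
proof -
  \<comment> \<open>The signed integral from 0 to x: for every x one of the two intervals is empty
    or a point.\<close>
  define F where "F x = integral {0..x} f - integral {x..0} f" for x
  have "(F has_real_derivative f x) (at x)" for x
  proof -
    define c where "c = - \<bar>x\<bar> - 1"
    have c: "c < 0" "c < x" by (auto simp: c_def)
    have fi: "f integrable_on {u..v}" for u v
      using assms by (intro integrable_continuous_real) (auto intro: continuous_on_subset)
    have "F y = integral {c..y} f - integral {c..0} f" if "c \<le> y" for y
    proof (cases "y \<ge> 0")
      case True
      then show ?thesis
        using Henstock_Kurzweil_Integration.integral_combine[of c 0 y f] c fi 
        by (cases "y = 0") (auto simp: F_def)
    next
      case False
      then show ?thesis
        using Henstock_Kurzweil_Integration.integral_combine[of c y 0 f] c fi that
        by (auto simp: F_def)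
    qed
    then have ev: "eventually (\<lambda>y. F y = integral {c..y} f - integral {c..0} f) (nhds x)"
      using eventually_nhds_in_open[of "{c<..}" x] c by (auto elim!: eventually_mono)
    have "((\<lambda>y. integral {c..y} f) has_real_derivative f x) (at x within {c..x+1})"
      by (rule integral_has_real_derivative) (use assms c in \<open>auto intro: continuous_on_subset\<close>)
    then have "((\<lambda>y. integral {c..y} f) has_real_derivative f x) (at x)"
      using at_within_interior[of x "{c..x+1}"] c by (auto simp: interior_atLeastAtMost_real)
    then have "((\<lambda>y. integral {c..y} f - integral {c..0} f) has_real_derivative f x) (at x)"
      by (auto intro!: derivative_eq_intros)
    then show ?thesis using ev by (subst DERIV_cong_ev[OF refl _ refl]) auto
  qed
  then show ?thesis using that by blast
qed

lemma smooth_continuous_on: "smooth f \<Longrightarrow> continuous_on A f"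
  by (meson DERIV_isCont continuous_at_imp_continuous_on smooth_DERIV)

text \<open>The normalized antiderivative of a bump that is positive at 1/2 and vanishes outside the
  open unit interval.\<close>

lemma smooth_step_exists:
  obtains S :: "real \<Rightarrow> real" where "smooth S" "\<And>x. x \<le> 0 \<Longrightarrow> S x = 0" "\<And>x. 1 \<le> x \<Longrightarrow> S x = 1"
    "\<And>x. 0 \<le> S x" "\<And>x. S x \<le> 1"
proof -
  define b where "b x = exp_inv 1 x * exp_inv 1 ((-1) * x + 1)" for x
  have sb: "smooth b" unfolding b_def by (intro smooth_mult smooth_exp_inv smooth_affine)
  have b0: "b x \<ge> 0" for x by (auto simp: b_def exp_inv_def)
  have bz: "b x = 0" if "x \<le> 0 \<or> x \<ge> 1" for x using that by (auto simp: b_def exp_inv_def)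
  have bp: "b (1/2) > 0" by (auto simp: b_def exp_inv_def)
  obtain B where B: "\<And>x. (B has_real_derivative b x) (at x)"
    using continuous_antiderivative smooth_continuous_on[OF sb] by blast
  have mono: "B x \<le> B y" if "x \<le> y" for x y
    by (rule DERIV_nonneg_imp_nondecreasing[OF that]) (use B b0 in blast)
  have lt: "B 0 < B 1"
  proof (rule ccontr)
    assume "\<not> B 0 < B 1"
    then have eq: "B x = B 0" if "0 \<le> x" "x \<le> 1" for x using mono[of 0 x] mono[of x 1] that by auto
    have "eventually (\<lambda>x. B x = B 0) (nhds (1/2))"
      by (rule eventually_mono[OF eventually_nhds_in_open[of "{0<..<1::real}"]]) (auto intro: eq)
    then have "(B has_real_derivative 0) (at (1/2))" by (subst DERIV_cong_ev[OF refl _ refl]) auto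
    with B[of "1/2"] bp show False using DERIV_unique by force
  qed
  define S where "S x = inverse (B 1 - B 0) * (B x - B 0)" for x
  have c0: "B x = B 0" if "x \<le> 0" for x 
    using DERIV_zero_const_on[of x 0 B] that B bz by (metis order_trans)
  have c1: "B x = B 1" if "1 \<le> x" for x 
    using DERIV_zero_const_on[of 1 x B] that B bz by (metis order_trans)
  show ?thesis
  proof
    have "(S has_real_derivative inverse (B 1 - B 0) * b x) (at x)" for x
      unfolding S_def using DERIV_diff[OF B DERIV_const, of "B 0" x] by (intro DERIV_cmult) simp
    then show "smooth S" by (rule smooth_if_deriv) (intro smooth_mult smooth_const sb)
    show "S x = 0" if "x \<le> 0" for x using c0[OF that] by (simp add: S_def)
    show "S x = 1" if "1 \<le> x" for x using c1[OF that] lt by (simp add: S_def)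
    have "B 0 \<le> B x \<and> B x \<le> B 1" for x
      using mono[of 0 x] mono[of x 1] c0[of x] c1[of x] lt
      by (cases "x \<le> 0"; cases "x \<ge> 1") auto
    then show "0 \<le> S x" "S x \<le> 1" for x using lt by (auto simp: S_def field_simps)
  qed
qed

section \<open>Weak derivatives on the half-line\<close>

lemma compact_Ioi_subset:
  fixes K :: "real set"
  assumes "compact K" "K \<subseteq> {0<..}"
  obtains a b where "0 < a" "a \<le> b" "K \<subseteq> {a..b}"
proof (cases "K = {}")
  case True then show ?thesis using that[of 1 1] by auto
next
  case False
  obtain l where l: "l \<in> K" "\<And>x. x \<in> K \<Longrightarrow> l \<le> x"
    using compact_attains_inf[OF assms(1) False] by blast
  obtain u where u: "u \<in> K" "\<And>x. x \<in> K \<Longrightarrow> x \<le> u"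
    using compact_attains_sup[OF assms(1) False] by blast
  show ?thesis
  proof (rule that)
    show "0 < l" using l(1) assms(2) by auto
    show "l \<le> u" using u(2)[OF l(1)] .
    show "K \<subseteq> {l..u}" using l(2) u(2) by auto
  qed
qed

lemma borel_measurable_Ioi:
  fixes g :: "real \<Rightarrow> real"
  assumes "\<And>a b. 0 < a \<Longrightarrow> a \<le> b \<Longrightarrow> g \<in> borel_measurable (lebesgue_on {a..b})"
  shows "g \<in> borel_measurable (lebesgue_on {0<..})"
proof -
  define I where "I n = {inverse (real (Suc n))..real (Suc n)}" for n
  have "(\<lambda>x. if x \<in> I n then g x else 0) \<in> borel_measurable lebesgue" for n
    using assms[of "inverse (real (Suc n))" "real (Suc n)"]
    unfolding I_def by (subst borel_measurable_if) (auto simp: field_simps)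
  then have "(\<lambda>x. if x \<in> I n then g x else 0) \<in> borel_measurable (lebesgue_on {0<..})" for n
    by (rule measurable_restrict_space1)
  moreover have "(\<lambda>n. if x \<in> I n then g x else 0) \<longlonglongrightarrow> g x" if "x \<in> space (lebesgue_on {0<..})" for x
  proof -
    have x: "x > 0" using that by simp
    have "eventually (\<lambda>n. inverse (real (Suc n)) < x) sequentially"
      using LIMSEQ_inverse_real_of_nat x by (rule order_tendstoD(2))
    moreover have "eventually (\<lambda>n. x < real (Suc n)) sequentially"
      using filterlim_real_sequentially filterlim_at_top_dense[of real] 
      by (auto elim!: eventually_mono dest!: spec[of _ x])
    ultimately have "eventually (\<lambda>n. (if x \<in> I n then g x else 0) = g x) sequentially"
      by eventually_elim (simp only: I_def atLeastAtMost_iff less_imp_le simp_thms if_True)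
    then show ?thesis by (rule tendsto_eventually)
  qed
  ultimately show ?thesis by (rule borel_measurable_LIMSEQ_real[rotated])
qed

text \<open>The space \<open>Lp_loc {0<..} 1\<close> in terms of intervals, where the calculus of
  gauge integrals applies; \<open>Lp_loc_1_iff\<close> identifies the two.\<close>

definition loc_int :: "(real \<Rightarrow> real) \<Rightarrow> bool" where
  "loc_int g \<longleftrightarrow> (\<forall>a b. 0 < a \<longrightarrow> a \<le> b \<longrightarrow> g absolutely_integrable_on {a..b})"

lemma loc_intD: "loc_int g \<Longrightarrow> 0 < a \<Longrightarrow> a \<le> b \<Longrightarrow> g absolutely_integrable_on {a..b}"
  by (auto simp: loc_int_def)

lemma loc_int_integrable: "loc_int g \<Longrightarrow> 0 < a \<Longrightarrow> g integrable_on {a..b}"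
  by (cases "a \<le> b") (auto simp: loc_int_def absolutely_integrable_on_def)

lemma loc_ac_loc_int: "loc_ac F g \<Longrightarrow> loc_int g"
  by (auto simp: loc_int_def loc_ac_def)

lemma loc_int_continuous: "continuous_on {0<..} f \<Longrightarrow> loc_int f"
  unfolding loc_int_def
  by (auto intro!: absolutely_integrable_continuous_real elim!: continuous_on_subset)

lemma loc_int_measurable: "loc_int g \<Longrightarrow> g \<in> borel_measurable (lebesgue_on {0<..})"
  by (rule borel_measurable_Ioi) (auto intro!: absolutely_integrable_imp_borel_measurable loc_intD)

lemma loc_int_mult_continuous:
  assumes "loc_int g" "continuous_on {0<..} h"
  shows "loc_int (\<lambda>x. g x * h x)"
  unfolding loc_int_def
proof (intro allI impI)
  fix a b :: real assume ab: "0 < a" "a \<le> b"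
  then have c: "continuous_on {a..b} h" by (intro continuous_on_subset[OF assms(2)]) auto
  have "(\<lambda>x. h x * g x) absolutely_integrable_on {a..b}"
  proof (rule absolutely_integrable_bounded_measurable_product_real)
    show "h \<in> borel_measurable (lebesgue_on {a..b})"
      by (rule continuous_imp_measurable_on_sets_lebesgue[OF c]) auto
    show "bounded (h ` {a..b})"
      by (intro compact_imp_bounded compact_continuous_image c) auto
    show "g absolutely_integrable_on {a..b}" using loc_intD[OF assms(1) ab] .
  qed auto
  then show "(\<lambda>x. g x * h x) absolutely_integrable_on {a..b}" by (simp add: mult.commute)
qed

lemma loc_int_diff: "loc_int f \<Longrightarrow> loc_int g \<Longrightarrow> loc_int (\<lambda>x. f x - g x)"
  unfolding loc_int_def by (auto intro: set_integral_diff)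

lemma Lp_loc_1_iff: "f \<in> Lp_loc {0<..} 1 \<longleftrightarrow> loc_int f"
proof
  assume f: "f \<in> Lp_loc {0<..} 1"
  show "loc_int f" unfolding loc_int_def
  proof (intro allI impI)
    fix a b :: real assume ab: "0 < a" "a \<le> b"
    then have sub: "{a..b} \<subseteq> {0<..}" by auto
    have m: "f \<in> borel_measurable (lebesgue_on {a..b})"
      using f by (intro measurable_restrict_mono[OF _ sub]) (simp add: Lp_loc_def)
    have "(\<integral>\<^sup>+x. ennreal (\<bar>f x\<bar> powr 1) \<partial>lebesgue_on {a..b}) < \<infinity>"
      using f sub by (auto simp: Lp_loc_def)
    then have "(\<integral>\<^sup>+x. ennreal (norm (f x)) \<partial>lebesgue_on {a..b}) < \<infinity>" by simp
    with m have "integrable (lebesgue_on {a..b}) f" by (rule integrableI_bounded)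
    then show "f absolutely_integrable_on {a..b}"
      by (simp add: set_integrable_def integrable_restrict_space)
  qed
next
  assume f: "loc_int f"
  have "(\<integral>\<^sup>+x. ennreal (\<bar>f x\<bar> powr 1) \<partial>lebesgue_on K) < \<infinity>" if K: "compact K" "K \<subseteq> {0<..}" for K
  proof -
    obtain a b where ab: "0 < a" "a \<le> b" "K \<subseteq> {a..b}" using compact_Ioi_subset K by blast
    have "integrable lebesgue (\<lambda>x. indicator {a..b} x *\<^sub>R f x)"
      using loc_intD[OF f ab(1,2)] by (simp add: set_integrable_def)
    then have fin: "(\<integral>\<^sup>+x. ennreal (norm (indicator {a..b} x *\<^sub>R f x)) \<partial>lebesgue) < \<infinity>"
      by (simp add: integrable_iff_bounded)
    have "(\<integral>\<^sup>+x. ennreal (\<bar>f x\<bar> powr 1) \<partial>lebesgue_on K)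
        = (\<integral>\<^sup>+x. ennreal (\<bar>f x\<bar> powr 1) * indicator K x \<partial>lebesgue)"
      using K(1) by (intro nn_integral_restrict_space) (auto simp: compact_imp_closed)
    also have "\<dots> \<le> (\<integral>\<^sup>+x. ennreal (norm (indicator {a..b} x *\<^sub>R f x)) \<partial>lebesgue)"
      using ab(3) by (intro nn_integral_mono) (auto simp: indicator_def)
    finally show ?thesis using fin by (rule le_less_trans)
  qed
  then show "f \<in> Lp_loc {0<..} 1" using loc_int_measurable[OF f] by (auto simp: Lp_loc_def)
qed

section \<open>Test functions on the half-line and integration against them\<close>

lemma test_function_smooth: "test_function \<Omega> \<phi> \<Longrightarrow> smooth \<phi>"
  by (auto simp: test_function_def smooth_def)

lemma test_functionI:
  assumes "smooth \<phi>" "0 < a" "\<And>x. x \<notin> {a..b} \<Longrightarrow> \<phi> x = 0"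
  shows "test_function {0<..} \<phi>"
proof -
  have sub: "closure {x. \<phi> x \<noteq> 0} \<subseteq> {a..b}"
    by (rule closure_minimal) (use assms(3) in blast, simp)
  then have "compact (closure {x. \<phi> x \<noteq> 0})"
    by (metis bounded_closed_interval bounded_subset closed_closure compact_eq_bounded_closed)
  then show ?thesis using sub assms by (auto simp: test_function_def smooth_def)
qed

lemma test_functionE:
  assumes "test_function {0<..} \<phi>"
  obtains a b where "0 < a" "a \<le> b" "\<And>x. x \<notin> {a..b} \<Longrightarrow> \<phi> x = 0" "\<And>x. x \<notin> {a..b} \<Longrightarrow> deriv \<phi> x = 0"
proof -
  obtain a b where ab: "0 < a" "a \<le> b" "closure {x. \<phi> x \<noteq> 0} \<subseteq> {a..b}"
    using compact_Ioi_subset[of "closure {x. \<phi> x \<noteq> 0}"] assms unfolding test_function_def by blast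
  have z: "\<phi> x = 0" if "x \<notin> {a..b}" for x 
    using ab(3) closure_subset[of "{x. \<phi> x \<noteq> 0}"] that by blast
  have "deriv \<phi> x = 0" if "x \<notin> {a..b}" for x
  proof -
    have "eventually (\<lambda>y. \<phi> y = 0) (nhds x)"
      by (rule eventually_mono[OF eventually_nhds_in_open[of "- {a..b}"]])
        (use that z in \<open>auto simp: closed_Compl\<close>)
    then have "deriv \<phi> x = deriv (\<lambda>y. 0) x" by (rule deriv_cong_ev) simp
    then show ?thesis by simp
  qed
  with that ab z show ?thesis by blast
qed

lemma integral_Ioi_support:
  fixes h :: "real \<Rightarrow> real"
  assumes h: "h absolutely_integrable_on {a..b}" and "0 < a" and z: "\<And>x. x \<notin> {a..b} \<Longrightarrow> h x = 0"
  shows "integrable (lebesgue_on {0<..}) h" "(\<integral>x. h x \<partial>lebesgue_on {0<..}) = integral {a..b} h"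
proof -
  have h_eq: "h = (\<lambda>x. if x \<in> {a..b} then h x else 0)" using z by auto
  have "h absolutely_integrable_on UNIV"
    by (subst h_eq) (use h in \<open>simp only: absolutely_integrable_restrict_UNIV\<close>)
  then have "h absolutely_integrable_on {0<..}"
    by (rule set_integrable_subset) auto
  then show i: "integrable (lebesgue_on {0<..}) h"
    by (rule absolutely_integrable_imp_integrable) auto
  have "(\<integral>x. h x \<partial>lebesgue_on {0<..}) = integral {0<..} h"
    by (rule lebesgue_integral_eq_integral[OF i]) auto
  also have "\<dots> = integral {a..b} h"
    using integral_restrict_Int[of "{0<..}" "{a..b}" h, folded h_eq] assms(2)
    by (simp add: inf_absorb1 inf_absorb2 subset_iff)
  finally show "(\<integral>x. h x \<partial>lebesgue_on {0<..}) = integral {a..b} h" .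
qed

lemma integral_mult_support:
  assumes "loc_int u" "continuous_on UNIV \<phi>" "0 < a" "a \<le> b" "\<And>x. x \<notin> {a..b} \<Longrightarrow> \<phi> x = 0"
  shows "integrable (lebesgue_on {0<..}) (\<lambda>x. u x * \<phi> x)"
    "(\<integral>x. u x * \<phi> x \<partial>lebesgue_on {0<..}) = integral {a..b} (\<lambda>x. u x * \<phi> x)"
proof -
  have "(\<lambda>x. u x * \<phi> x) absolutely_integrable_on {a..b}"
    by (intro loc_intD loc_int_mult_continuous assms continuous_on_subset[OF assms(2) subset_UNIV])
  note * = integral_Ioi_support[OF this assms(3)]
  show "integrable (lebesgue_on {0<..}) (\<lambda>x. u x * \<phi> x)" using assms(5) by (intro *) auto
  show "(\<integral>x. u x * \<phi> x \<partial>lebesgue_on {0<..}) = integral {a..b} (\<lambda>x. u x * \<phi> x)"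
    using assms(5) by (intro *) auto
qed

lemma test_function_mult_integrable:
  assumes "loc_int u" "test_function {0<..} \<phi>"
  shows "integrable (lebesgue_on {0<..}) (\<lambda>x. u x * \<phi> x)"
    "integrable (lebesgue_on {0<..}) (\<lambda>x. u x * deriv \<phi> x)"
proof -
  have s: "smooth \<phi>" using assms(2) by (rule test_function_smooth)
  obtain a b where ab: "0 < a" "a \<le> b" and z: "\<And>x. x \<notin> {a..b} \<Longrightarrow> \<phi> x = 0"
    "\<And>x. x \<notin> {a..b} \<Longrightarrow> deriv \<phi> x = 0" using assms(2) by (rule test_functionE) blast
  show "integrable (lebesgue_on {0<..}) (\<lambda>x. u x * \<phi> x)"
    by (rule integral_mult_support(1)[OF assms(1) smooth_continuous_on[OF s] ab z(1)])
  show "integrable (lebesgue_on {0<..}) (\<lambda>x. u x * deriv \<phi> x)"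
    by (rule integral_mult_support(1)[OF assms(1) smooth_continuous_on[OF smooth_deriv[OF s]] ab z(2)])
qed

text \<open>Integration by parts: the product rule for \<open>loc_ac\<close> is integrated over an
  interval containing the support of the test function.\<close>

lemma loc_ac_is_weak_deriv:
  assumes F: "loc_ac F g"
  shows "is_weak_deriv {0<..} F g"
  unfolding is_weak_deriv_def Lp_loc_1_iff
proof (intro conjI allI impI)
  show g: "loc_int g" using F by (rule loc_ac_loc_int)
  show Fi: "loc_int F" using F by (intro loc_int_continuous loc_ac_continuous)
  fix \<phi> assume t: "test_function {0<..} \<phi>"
  then obtain a b where ab: "0 < a" "a \<le> b" and z: "\<And>x. x \<notin> {a..b} \<Longrightarrow> \<phi> x = 0"
    "\<And>x. x \<notin> {a..b} \<Longrightarrow> deriv \<phi> x = 0" by (rule test_functionE) blast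
  have s: "smooth \<phi>" using t by (rule test_function_smooth)
  \<comment> \<open>The facts \<open>z\<close> say nothing at the endpoints of
    \<open>{a..b}\<close>; on the enlarged interval the boundary terms vanish.\<close>
  define c d where "c = a/2" and "d = b + 1"
  have cd: "0 < c" "c \<le> d" "c < a" "b < d" using ab by (auto simp: c_def d_def)
  have ac: "loc_ac (\<lambda>x. F x * \<phi> x) (\<lambda>x. g x * \<phi> x + F x * deriv \<phi> x)"
    by (intro loc_ac_mult[OF F] loc_ac_C1 smooth_DERIV s smooth_continuous_on smooth_deriv)
  have i: "(\<lambda>x. g x * \<phi> x) integrable_on {c..d}" "(\<lambda>x. F x * deriv \<phi> x) integrable_on {c..d}"
    by (intro loc_int_integrable loc_int_mult_continuous g Fi cd smooth_continuous_on smooth_deriv s)+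
  have "0 = integral {c..d} (\<lambda>x. g x * \<phi> x + F x * deriv \<phi> x)"
    using loc_acD(4)[OF ac cd(1,2)] z(1)[of c] z(1)[of d] cd by simp
  also have "\<dots> = integral {c..d} (\<lambda>x. g x * \<phi> x) + integral {c..d} (\<lambda>x. F x * deriv \<phi> x)"
    by (rule integral_add[OF i])
  also have "integral {c..d} (\<lambda>x. g x * \<phi> x) = (\<integral>x. g x * \<phi> x \<partial>lebesgue_on {0<..})"
    by (intro integral_mult_support(2)[symmetric] g smooth_continuous_on s cd z) (use cd in auto)
  also have "integral {c..d} (\<lambda>x. F x * deriv \<phi> x) = (\<integral>x. F x * deriv \<phi> x \<partial>lebesgue_on {0<..})"
    by (intro integral_mult_support(2)[symmetric] Fi smooth_continuous_on s smooth_deriv cd z) (use cd in auto)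
  finally show "(\<integral>x. F x * deriv \<phi> x \<partial>lebesgue_on {0<..}) = - (\<integral>x. g x * \<phi> x \<partial>lebesgue_on {0<..})"
    by simp
qed

text \<open>The difference of two ever steeper smooth steps at \<open>a\<close> and \<open>b\<close>
  converges to the indicator of \<open>{a<..b}\<close>, is bounded by 1, and stays supported in
  \<open>{a..b+1}\<close> because the steepness is at least 1. One sequence serves all
  \<open>u\<close>, by dominated convergence.\<close>

lemma test_function_approx_indicator:
  fixes a b :: real
  assumes ab: "0 < a" "a < b"
  obtains T where "\<And>n::nat. test_function {0<..} (T n)"
    "\<And>u. loc_int u \<Longrightarrow> (\<lambda>n. \<integral>x. u x * T n x \<partial>lebesgue_on {0<..}) \<longlonglongrightarrow> integral {a..b} u"
proof -
  obtain S :: "real \<Rightarrow> real" where S: "smooth S" and S0: "\<And>x. x \<le> 0 \<Longrightarrow> S x = 0"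
    and S1: "\<And>x. 1 \<le> x \<Longrightarrow> S x = 1" and Sb: "\<And>x. 0 \<le> S x" "\<And>x. S x \<le> 1"
    using smooth_step_exists by blast
  define N where "N n = real (Suc n)" for n
  have N: "N n \<ge> 1" for n by (simp add: N_def)
  define T where "T n x = S (N n * x + - (N n * a)) - S (N n * x + - (N n * b))" for n x
  have T_alt: "T n x = S (N n * (x - a)) - S (N n * (x - b))" for n x
    by (simp add: T_def algebra_simps)
  have sT: "smooth (T n)" for n unfolding T_def by (intro smooth_diff smooth_affine S)
  have Tz: "T n x = 0" if "x \<notin> {a..b+1}" for n x
  proof -
    have "x < a \<or> b + 1 < x" using that by auto
    then show ?thesis
    proof
      assume "x < a"
      then have "N n * (x - a) \<le> 0" "N n * (x - b) \<le> 0"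
        using N[of n] ab by (auto intro!: mult_nonneg_nonpos)
      then show ?thesis by (simp add: T_alt S0)
    next
      assume "b + 1 < x"
      then have "1 \<le> N n * (x - a)" "1 \<le> N n * (x - b)"
        using N[of n] ab mult_mono[of 1 "N n" 1 "x - a"] mult_mono[of 1 "N n" 1 "x - b"] by auto
      then show ?thesis by (simp add: T_alt S1)
    qed
  qed
  have Tlim: "(\<lambda>n. T n x) \<longlonglongrightarrow> indicator {a<..b} x" for x
  proof -
    have step: "(\<lambda>n. S (N n * (x - c))) \<longlonglongrightarrow> (if c < x then 1 else 0)" for c
    proof (cases "c < x")
      case True
      have "eventually (\<lambda>n. inverse (real (Suc n)) < x - c) sequentially"
        using LIMSEQ_inverse_real_of_nat True by (intro order_tendstoD(2)) auto
      then have "eventually (\<lambda>n. S (N n * (x - c)) = 1) sequentially"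
      proof eventually_elim
        case (elim n)
        then have "1 \<le> N n * (x - c)" by (simp add: N_def field_simps)
        then show ?case by (rule S1)
      qed
      then show ?thesis using True by (auto intro: tendsto_eventually)
    next
      case False
      then have "N n * (x - c) \<le> 0" for n using N[of n] by (intro mult_nonneg_nonpos) auto
      then show ?thesis using False by (simp add: S0)
    qed
    have "(\<lambda>n. T n x) \<longlonglongrightarrow> (if a < x then 1 else 0) - (if b < x then 1 else 0)"
      unfolding T_alt by (intro tendsto_diff step)
    then show ?thesis using ab by (auto simp: indicator_def split: if_splits)
  qed
  have Tb: "\<bar>T n x\<bar> \<le> 1" for n x
    using Sb[of "N n * (x - a)"] Sb[of "N n * (x - b)"] unfolding T_alt abs_le_iff by linarith
  show ?thesis
  proof
    show "test_function {0<..} (T n)" for n by (rule test_functionI[OF sT ab(1) Tz])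
    fix u assume u: "loc_int u"
    have I: "(\<integral>x. u x * T n x \<partial>lebesgue_on {0<..}) = integral {a..b+1} (\<lambda>x. u x * T n x)" for n
      by (rule integral_mult_support(2)[OF u smooth_continuous_on[OF sT]]) (use ab Tz in auto)
    have "(\<lambda>n. integral {a..b+1} (\<lambda>x. u x * T n x)) \<longlonglongrightarrow> integral {a..b+1} (\<lambda>x. u x * indicator {a<..b} x)"
    proof (rule dominated_convergence(2))
      show "(\<lambda>x. u x * T n x) integrable_on {a..b+1}" for n
        by (intro loc_int_integrable loc_int_mult_continuous u ab smooth_continuous_on sT)
      show "(\<lambda>x. \<bar>u x\<bar>) integrable_on {a..b+1}"
        using loc_intD[OF u, of a "b+1"] ab by (auto simp: absolutely_integrable_on_def)
      show "norm (u x * T n x) \<le> \<bar>u x\<bar>" for n x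
        using mult_left_mono[OF Tb[of n x], of "\<bar>u x\<bar>"] by (simp add: abs_mult)
      show "(\<lambda>n. u x * T n x) \<longlonglongrightarrow> u x * indicator {a<..b} x" for x
        by (intro tendsto_intros Tlim)
    qed
    also have "integral {a..b+1} (\<lambda>x. u x * indicator {a<..b} x)
      = integral {a..b+1} (\<lambda>x. if x \<in> {a..b} then u x else 0)"
      by (rule integral_spike[of "{a}"]) (auto simp: indicator_def)
    also have "\<dots> = integral {a..b} u"
      unfolding integral_restrict_Int by (simp add: inf_absorb1 inf_absorb2 subset_iff)
    finally show "(\<lambda>n. \<integral>x. u x * T n x \<partial>lebesgue_on {0<..}) \<longlonglongrightarrow> integral {a..b} u"
      unfolding I .
  qed
qed

lemma fundamental_lemma_calculus_of_variations:
  assumes u: "loc_int u"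
    and z: "\<And>\<phi>. test_function {0<..} \<phi> \<Longrightarrow> (\<integral>x. u x * \<phi> x \<partial>lebesgue_on {0<..}) = 0"
  shows "AE x in lebesgue_on {0<..}. u x = 0"
proof (rule AE_zero_if_interval_integrals_zero)
  fix a b :: real assume ab: "0 < a" "a < b"
  obtain T where T: "\<And>n::nat. test_function {0<..} (T n)"
    "(\<lambda>n. \<integral>x. u x * T n x \<partial>lebesgue_on {0<..}) \<longlonglongrightarrow> integral {a..b} u"
    using test_function_approx_indicator[OF ab] u by metis
  then show "integral {a..b} u = 0" using z by (simp add: LIMSEQ_const_iff)
qed (rule loc_intD[OF u])

lemma weak_deriv_unique_AE:
  assumes "is_weak_deriv {0<..} f g" "is_weak_deriv {0<..} f g'"
  shows "AE x in lebesgue_on {0<..}. g x = g' x"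
proof -
  have g: "loc_int g" "loc_int g'" using assms by (auto simp: is_weak_deriv_def Lp_loc_1_iff)
  have "AE x in lebesgue_on {0<..}. g x - g' x = 0"
  proof (rule fundamental_lemma_calculus_of_variations)
    show "loc_int (\<lambda>x. g x - g' x)" using g by (rule loc_int_diff)
    fix \<phi> assume t: "test_function {0<..} \<phi>"
    have "(\<integral>x. (g x - g' x) * \<phi> x \<partial>lebesgue_on {0<..})
      = (\<integral>x. g x * \<phi> x \<partial>lebesgue_on {0<..}) - (\<integral>x. g' x * \<phi> x \<partial>lebesgue_on {0<..})"
      using test_function_mult_integrable(1)[OF g(1) t] test_function_mult_integrable(1)[OF g(2) t]
      by (simp add: left_diff_distrib)
    also have "\<dots> = 0" using assms t by (auto simp: is_weak_deriv_def)
    finally show "(\<integral>x. (g x - g' x) * \<phi> x \<partial>lebesgue_on {0<..}) = 0" .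
  qed
  then show ?thesis by eventually_elim simp
qed

text \<open>A function \<open>w\<close> is the derivative of a test function once its mean is
  removed, which is done with a fixed \<eta> of non-zero integral. The hypothesis then says that
  \<open>u\<close> minus a constant is orthogonal to every test function.\<close>

lemma du_Bois_Reymond:
  assumes u: "loc_int u"
    and z: "\<And>\<phi>. test_function {0<..} \<phi> \<Longrightarrow> (\<integral>x. u x * deriv \<phi> x \<partial>lebesgue_on {0<..}) = 0"
  obtains c where "AE x in lebesgue_on {0<..}. u x = c"
proof -
  let ?I = "\<lambda>f. \<integral>x. f x \<partial>lebesgue_on {0<..}"
  have one: "loc_int (\<lambda>x. 1)" by (intro loc_int_continuous continuous_intros)
  obtain \<eta> where \<eta>: "test_function {0<..} \<eta>" "?I \<eta> \<noteq> 0"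
  proof -
    obtain T where T: "\<And>n::nat. test_function {0<..} (T n)"
      "\<And>u. loc_int u \<Longrightarrow> (\<lambda>n. ?I (\<lambda>x. u x * T n x)) \<longlonglongrightarrow> integral {1..2} u"
      using test_function_approx_indicator[of 1 2] by auto
    have "(\<lambda>n. ?I (T n)) \<longlonglongrightarrow> 1" using T(2)[OF one] by simp
    then have "\<exists>n. ?I (T n) \<noteq> 0"
      by (rule contrapos_pp) (simp add: LIMSEQ_const_iff)
    with T that show ?thesis by blast
  qed
  define K where "K = ?I (\<lambda>x. u x * \<eta> x) / ?I \<eta>"
  have "AE x in lebesgue_on {0<..}. u x - K = 0"
  proof (rule fundamental_lemma_calculus_of_variations)
    show "loc_int (\<lambda>x. u x - K)" by (intro loc_int_diff[OF u] loc_int_continuous continuous_intros)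
    fix w assume w: "test_function {0<..} w"
    define c where "c = ?I w / ?I \<eta>"
    define v where "v x = w x - c * \<eta> x" for x
    have sv: "smooth v" unfolding v_def
      by (intro smooth_diff smooth_mult smooth_const test_function_smooth[OF w] test_function_smooth[OF \<eta>(1)])
    obtain a b where ab: "0 < a" "a \<le> b" "\<And>x. x \<notin> {a..b} \<Longrightarrow> w x = 0" using w by (rule test_functionE) blast
    obtain a' b' where ab': "0 < a'" "a' \<le> b'" "\<And>x. x \<notin> {a'..b'} \<Longrightarrow> \<eta> x = 0"
      using \<eta>(1) by (rule test_functionE) blast
    \<comment> \<open>The interval contains both supports in its interior, so \<open>v\<close>
      vanishes at its endpoints as well.\<close>
    define A B where "A = min a a' / 2" and "B = max b b' + 1"
    have AB: "0 < A" "A \<le> B" using ab ab' by (auto simp: A_def B_def)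
    have vz: "v x = 0" if "x \<le> A \<or> B \<le> x" for x
    proof -
      have "x \<notin> {a..b}" "x \<notin> {a'..b'}" using that ab(1) ab'(1) by (auto simp: A_def B_def)
      then show ?thesis using ab(3) ab'(3) by (simp add: v_def)
    qed
    have iw: "integrable (lebesgue_on {0<..}) w" "integrable (lebesgue_on {0<..}) \<eta>"
      using test_function_mult_integrable(1)[OF one w] test_function_mult_integrable(1)[OF one \<eta>(1)] by auto
    have "integral {A..B} v = ?I v"
      using integral_mult_support(2)[OF one smooth_continuous_on[OF sv] AB] vz by force
    also have "\<dots> = ?I w - c * ?I \<eta>" unfolding v_def using iw by simp
    also have "\<dots> = 0" using \<eta>(2) by (simp add: c_def)
    finally have int0: "integral {A..B} v = 0" .
    obtain V where V: "\<And>x. (V has_real_derivative v x) (at x)"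
      using continuous_antiderivative smooth_continuous_on[OF sv] by blast
    have "(v has_integral V B - V A) {A..B}"
      by (rule fundamental_theorem_of_calculus[OF AB(2)])
        (use V in \<open>auto simp: has_real_derivative_iff_has_vector_derivative[symmetric] intro: has_field_derivative_at_within\<close>)
    then have VAB: "V B = V A" using int0 by (simp add: integral_unique)
    have VA: "V x = V A" if "x \<le> A" for x
      by (rule DERIV_zero_const_on[of x A V]) (use that V vz in \<open>metis order_trans\<close>)+
    have VB: "V x = V A" if "B \<le> x" for x
      unfolding VAB[symmetric]
      by (rule DERIV_zero_const_on[of B x V, symmetric]) (use that V vz in \<open>metis order_trans\<close>)+
    \<comment> \<open>Since \<open>v\<close> has mean zero, its antiderivative takes the same
      constant value on both sides of \<open>{A..B}\<close>; subtracting it gives compact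
      support.\<close>
    define \<phi> where "\<phi> x = V x - V A" for x
    have D: "(\<phi> has_real_derivative v x) (at x)" for x
      unfolding \<phi>_def using DERIV_diff[OF V DERIV_const, of "V A" x] by simp
    have d: "deriv \<phi> = v" using D by (auto intro!: DERIV_imp_deriv)
    have "test_function {0<..} \<phi>"
    proof (rule test_functionI[OF smooth_if_deriv[OF D sv] AB(1)])
      fix x assume "x \<notin> {A..B}"
      then have "x \<le> A \<or> B \<le> x" by auto
      then show "\<phi> x = 0" using VA[of x] VB[of x] by (auto simp: \<phi>_def)
    qed
    from z[OF this] have "0 = ?I (\<lambda>x. u x * v x)" by (simp add: d)
    also have "\<dots> = ?I (\<lambda>x. u x * w x) - c * ?I (\<lambda>x. u x * \<eta> x)"
      unfolding v_def using test_function_mult_integrable(1)[OF u w] test_function_mult_integrable(1)[OF u \<eta>(1)]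
      by (simp add: algebra_simps)
    also have "\<dots> = ?I (\<lambda>x. u x * w x) - K * ?I w" by (simp add: c_def K_def)
    also have "\<dots> = ?I (\<lambda>x. (u x - K) * w x)"
      using test_function_mult_integrable(1)[OF u w] iw by (simp add: left_diff_distrib)
    finally show "?I (\<lambda>x. (u x - K) * w x) = 0" by simp
  qed
  then have "AE x in lebesgue_on {0<..}. u x = K" by eventually_elim simp
  with that show ?thesis by blast
qed

lemma loc_int_antiderivative:
  assumes g: "loc_int g"
  obtains G where "loc_ac G g"
proof
  note gi = loc_int_integrable[OF g]
  show "loc_ac (\<lambda>x. integral {1..x} g - integral {x..1} g) g"
    unfolding loc_ac_def
  proof (intro allI impI conjI)
    fix a b :: real assume ab: "0 < a" "a \<le> b"
    show "g absolutely_integrable_on {a..b}" using g ab by (rule loc_intD)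
    have c: "integral {x..y} g + integral {y..z} g = integral {x..z} g" if "0 < x" "x \<le> y" "y \<le> z" for x y z
      by (rule Henstock_Kurzweil_Integration.integral_combine) (use that gi in auto)
    have e: "integral {x..y} g = 0" if "y \<le> x" for x y
      using that by (cases "x = y") auto
    consider "b \<le> 1" | "a \<le> 1" "1 \<le> b" | "1 \<le> a" by linarith
    then have "integral {a..b} g = integral {1..b} g - integral {b..1} g - (integral {1..a} g - integral {a..1} g)"
    proof cases
      case 1 then show ?thesis using c[of a b 1] e[of b 1] e[of a 1] ab by simp
    next
      case 2 then show ?thesis using c[of a 1 b] e[of 1 b] e[of a 1] ab by simp
    next
      case 3 then show ?thesis using c[of 1 a b] e[of 1 b] e[of 1 a] ab by simp
    qed
    then show "(g has_integral integral {1..b} g - integral {b..1} g - (integral {1..a} g - integral {a..1} g)) {a..b}"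
      using gi[OF ab(1)] by (metis has_integral_integral)
  qed
qed

text \<open>An antiderivative of \<open>g\<close> has the same weak derivative as \<open>f\<close>,
  so the two differ by a constant almost everywhere.\<close>

lemma weak_deriv_imp_loc_ac:
  assumes w: "is_weak_deriv {0<..} f g"
  obtains F where "loc_ac F g" "AE x in lebesgue_on {0<..}. f x = F x"
proof -
  have f: "loc_int f" and g: "loc_int g" using w by (auto simp: is_weak_deriv_def Lp_loc_1_iff)
  obtain G where G: "loc_ac G g" using loc_int_antiderivative[OF g] .
  have Gi: "loc_int G" using G by (intro loc_int_continuous loc_ac_continuous)
  obtain c where c: "AE x in lebesgue_on {0<..}. f x - G x = c"
  proof (rule du_Bois_Reymond)
    show "loc_int (\<lambda>x. f x - G x)" using f Gi by (rule loc_int_diff)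
    fix \<phi> assume t: "test_function {0<..} \<phi>"
    have "(\<integral>x. (f x - G x) * deriv \<phi> x \<partial>lebesgue_on {0<..})
      = (\<integral>x. f x * deriv \<phi> x \<partial>lebesgue_on {0<..}) - (\<integral>x. G x * deriv \<phi> x \<partial>lebesgue_on {0<..})"
      using test_function_mult_integrable(2)[OF f t] test_function_mult_integrable(2)[OF Gi t]
      by (simp add: left_diff_distrib)
    also have "\<dots> = 0" using w loc_ac_is_weak_deriv[OF G] t by (auto simp: is_weak_deriv_def)
    finally show "(\<integral>x. (f x - G x) * deriv \<phi> x \<partial>lebesgue_on {0<..}) = 0" .
  qed blast
  have "loc_ac (\<lambda>x. G x + c) g" using loc_ac_add[OF G loc_ac_const[of c]] by simp
  moreover have "AE x in lebesgue_on {0<..}. f x = G x + c" using c by eventually_elim simp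
  ultimately show ?thesis using that by blast
qed

section \<open>The radial energy\<close>

abbreviation Ioi_measure :: "real measure" ("\<mu>\<^sub>+") where "\<mu>\<^sub>+ \<equiv> lebesgue_on {0<..}"

text \<open>The derivative is a separate argument, which frees the energies from the choice made in
  \<open>weak_deriv\<close>; \<open>Ip_eq_energy\<close> and \<open>grad_energy_eq\<close> translate
  back.\<close>

definition grad_density :: "real \<Rightarrow> (real \<Rightarrow> real) \<Rightarrow> (real \<Rightarrow> real) \<Rightarrow> real \<Rightarrow> real" where
  "grad_density p F g r = ((g r)\<^sup>2 + (F r)\<^sup>2 / r\<^sup>2) powr (p / 2) * r"

definition grad_energy :: "real \<Rightarrow> (real \<Rightarrow> real) \<Rightarrow> (real \<Rightarrow> real) \<Rightarrow> ennreal" where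
  "grad_energy p F g = (\<integral>\<^sup>+r. ennreal (grad_density p F g r) \<partial>\<mu>\<^sub>+)"

definition energy :: "real \<Rightarrow> (real \<Rightarrow> real) \<Rightarrow> (real \<Rightarrow> real) \<Rightarrow> ennreal" where
  "energy p F g = (\<integral>\<^sup>+r. ennreal (grad_density p F g r + 1 / 2 * (1 - (F r)\<^sup>2)\<^sup>2 * r) \<partial>\<mu>\<^sub>+)"

lemma AE_Ioi: "AE r in \<mu>\<^sub>+. 0 < r"
  by (subst AE_lebesgue_on_iff) auto

lemma grad_density_nonneg: "0 < r \<Longrightarrow> 0 \<le> grad_density p F g r"
  by (simp add: grad_density_def)

lemma grad_energy_le_energy: "grad_energy p F g \<le> energy p F g"
  unfolding grad_energy_def energy_def
  by (rule nn_integral_mono_AE) (use AE_Ioi in eventually_elim, auto intro!: ennreal_leI)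

lemma loc_ac_measurable:
  assumes "loc_ac F g"
  shows "F \<in> borel_measurable \<mu>\<^sub>+" "g \<in> borel_measurable \<mu>\<^sub>+"
  using loc_int_measurable[OF loc_int_continuous[OF loc_ac_continuous[OF assms]]]
    loc_int_measurable[OF loc_ac_loc_int[OF assms]] .

lemma id_measurable_Ioi [measurable]: "(\<lambda>r. r) \<in> borel_measurable \<mu>\<^sub>+"
  by (rule loc_int_measurable) (intro loc_int_continuous continuous_intros)

lemma grad_density_measurable [measurable]:
  assumes [measurable]: "F \<in> borel_measurable \<mu>\<^sub>+" "g \<in> borel_measurable \<mu>\<^sub>+"
  shows "grad_density p F g \<in> borel_measurable \<mu>\<^sub>+"
  unfolding grad_density_def[abs_def] by measurable

text \<open>A compact subset of the half-line keeps a distance \<open>a\<close> from 0, and there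
  the weight satisfies \<open>1 \<le> x / a\<close>.\<close>

lemma Lp_locI_weighted:
  assumes m[measurable]: "u \<in> borel_measurable \<mu>\<^sub>+"
    and fin: "(\<integral>\<^sup>+r. ennreal (\<bar>u r\<bar> powr p * r) \<partial>\<mu>\<^sub>+) < \<infinity>"
  shows "u \<in> Lp_loc {0<..} p"
proof -
  have "(\<integral>\<^sup>+x. ennreal (\<bar>u x\<bar> powr p) \<partial>lebesgue_on K) < \<infinity>" if K: "compact K" "K \<subseteq> {0<..}" for K
  proof -
    obtain a b where ab: "0 < a" "a \<le> b" "K \<subseteq> {a..b}" using compact_Ioi_subset K by blast
    have "(\<integral>\<^sup>+x. ennreal (\<bar>u x\<bar> powr p) \<partial>lebesgue_on K)
        = (\<integral>\<^sup>+x. ennreal (\<bar>u x\<bar> powr p) * indicator K x \<partial>lebesgue)"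
      using K(1) by (intro nn_integral_restrict_space) (auto simp: compact_imp_closed)
    also have "\<dots> \<le> (\<integral>\<^sup>+x. (ennreal (1 / a) * ennreal (\<bar>u x\<bar> powr p * x)) * indicator {0<..} x \<partial>lebesgue)"
    proof (intro nn_integral_mono)
      fix x show "ennreal (\<bar>u x\<bar> powr p) * indicator K x
         \<le> (ennreal (1 / a) * ennreal (\<bar>u x\<bar> powr p * x)) * indicator {0<..} x"
      proof (cases "x \<in> K")
        case True
        then have x: "a \<le> x" using ab by auto
        have "\<bar>u x\<bar> powr p * 1 \<le> \<bar>u x\<bar> powr p * (1 / a * x)"
          using x ab by (intro mult_left_mono) (auto simp: field_simps)
        then have "ennreal (\<bar>u x\<bar> powr p) \<le> ennreal (1 / a * (\<bar>u x\<bar> powr p * x))"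
          by (intro ennreal_leI) (simp add: algebra_simps)
        then show ?thesis using True x ab by (simp add: ennreal_mult' [symmetric])
      qed simp
    qed
    also have "\<dots> = (\<integral>\<^sup>+x. ennreal (1 / a) * ennreal (\<bar>u x\<bar> powr p * x) \<partial>\<mu>\<^sub>+)"
      by (rule nn_integral_restrict_space[symmetric]) simp
    also have "\<dots> = ennreal (1 / a) * (\<integral>\<^sup>+x. ennreal (\<bar>u x\<bar> powr p * x) \<partial>\<mu>\<^sub>+)"
      by (rule nn_integral_cmult) measurable
    also have "\<dots> < \<infinity>" using fin by (simp add: ennreal_mult_less_top)
    finally show ?thesis .
  qed
  then show ?thesis using m by (auto simp: Lp_loc_def)
qed

lemma Lp_locI_continuous:
  assumes c: "continuous_on {0<..} F" and p: "p > 0"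
  shows "F \<in> Lp_loc {0<..} p"
proof -
  have "continuous_on {0<..} (\<lambda>x. \<bar>F x\<bar> powr p)"
    using p by (intro continuous_on_powr' continuous_intros c) auto
  then have "(\<lambda>x. \<bar>F x\<bar> powr p) \<in> Lp_loc {0<..} 1"
    unfolding Lp_loc_1_iff by (rule loc_int_continuous)
  then show ?thesis using loc_int_measurable[OF loc_int_continuous[OF c]] by (auto simp: Lp_loc_def)
qed

lemma is_weak_deriv_weak_deriv:
  "is_weak_deriv \<Omega> f g \<Longrightarrow> is_weak_deriv \<Omega> f (weak_deriv \<Omega> f)"
  unfolding weak_deriv_def by (rule someI[of "is_weak_deriv \<Omega> f"])

lemma weak_deriv_AE_eq:
  assumes "is_weak_deriv {0<..} f g"
  shows "AE r in \<mu>\<^sub>+. weak_deriv {0<..} f r = g r"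
  using is_weak_deriv_weak_deriv[OF assms] assms by (rule weak_deriv_unique_AE)

lemma Ip_eq_energy:
  assumes "AE r in \<mu>\<^sub>+. f r = F r" "AE r in \<mu>\<^sub>+. weak_deriv {0<..} f r = g r"
  shows "Ip p f = energy p F g"
  unfolding Ip_def energy_def
  by (rule nn_integral_cong_AE, use assms AE_Ioi in eventually_elim)
    (simp add: grad_density_def algebra_simps)

lemma grad_energy_eq:
  assumes "AE r in \<mu>\<^sub>+. f r = F r" "AE r in \<mu>\<^sub>+. weak_deriv {0<..} f r = g r"
  shows "(\<integral>\<^sup>+r. ennreal ((\<bar>weak_deriv {0<..} f r\<bar>\<^sup>2 + (f r)\<^sup>2 / r\<^sup>2) powr (p / 2) * r) \<partial>\<mu>\<^sub>+)
    = grad_energy p F g"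
  unfolding grad_energy_def
  by (rule nn_integral_cong_AE, use assms AE_Ioi in eventually_elim)
    (simp add: grad_density_def)

text \<open>Admits competitors: local p-integrability of \<open>g\<close> follows from the gradient
  energy and that of \<open>F\<close> from continuity, so finite gradient energy is the only
  condition to check.\<close>

lemma loc_ac_in_Xp:
  assumes F: "loc_ac F g" and fin: "grad_energy p F g < \<infinity>" and p: "p > 0"
  shows "F \<in> Xp p"
proof -
  note [measurable] = loc_ac_measurable[OF F]
  note w = loc_ac_is_weak_deriv[OF F]
  have "g \<in> Lp_loc {0<..} p"
  proof (rule Lp_locI_weighted)
    have "(\<integral>\<^sup>+r. ennreal (\<bar>g r\<bar> powr p * r) \<partial>\<mu>\<^sub>+) \<le> grad_energy p F g"
      unfolding grad_energy_def
    proof (rule nn_integral_mono_AE, use AE_Ioi in eventually_elim)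
      case (elim r)
      have g2: "(g r)\<^sup>2 = \<bar>g r\<bar> powr 2" by (cases "g r = 0") simp_all
      have "\<bar>g r\<bar> powr p = ((g r)\<^sup>2) powr (p / 2)" unfolding g2 by (subst powr_powr) simp
      also have "\<dots> \<le> ((g r)\<^sup>2 + (F r)\<^sup>2 / r\<^sup>2) powr (p / 2)"
        using p by (intro powr_mono2) auto
      finally show ?case using elim by (auto simp: grad_density_def intro!: ennreal_leI mult_right_mono)
    qed
    then show "(\<integral>\<^sup>+r. ennreal (\<bar>g r\<bar> powr p * r) \<partial>\<mu>\<^sub>+) < \<infinity>" using fin by (rule le_less_trans)
  qed measurable
  moreover have "F \<in> Lp_loc {0<..} p" by (rule Lp_locI_continuous[OF loc_ac_continuous[OF F] p])
  ultimately show ?thesis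
    using w fin grad_energy_eq[OF _ weak_deriv_AE_eq[OF w], of F p] by (auto simp: Xp_def W1p_loc_def)
qed

text \<open>The continuous representative may be taken non-negative everywhere, as \<open>\<bar>F\<bar>\<close> is again one.\<close>

lemma nonneg_minimizer_representative:
  assumes m: "nonneg_minimizer p f" and p: "p > 0"
  obtains F g where "loc_ac F g" "AE r in \<mu>\<^sub>+. f r = F r" "\<And>r. 0 \<le> F r" "grad_energy p F g < \<infinity>"
    "\<And>G k. loc_ac G k \<Longrightarrow> grad_energy p G k < \<infinity> \<Longrightarrow> energy p F g \<le> energy p G k"
proof -
  have X: "f \<in> Xp p" using m by (simp add: nonneg_minimizer_def)
  then obtain g0 where "is_weak_deriv {0<..} f g0" by (auto simp: Xp_def W1p_loc_def)
  then have w: "is_weak_deriv {0<..} f (weak_deriv {0<..} f)" by (rule is_weak_deriv_weak_deriv)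
  obtain F0 where F0: "loc_ac F0 (weak_deriv {0<..} f)" and fF0: "AE r in \<mu>\<^sub>+. f r = F0 r"
    using weak_deriv_imp_loc_ac[OF w] by blast
  define F g where "F = (\<lambda>r. \<bar>F0 r\<bar>)" and "g = (\<lambda>r. sgn (F0 r) * weak_deriv {0<..} f r)"
  have F: "loc_ac F g" unfolding F_def g_def by (rule loc_ac_abs[OF F0])
  have fF: "AE r in \<mu>\<^sub>+. f r = F r"
    using fF0 m unfolding nonneg_minimizer_def F_def by (auto elim!: eventually_elim2)
  \<comment> \<open>As \<open>f\<close> and \<open>\<bar>F0\<bar>\<close> agree almost everywhere,
    they have the same weak derivatives. Uniqueness then identifies the chosen
    \<open>weak_deriv\<close> with \<open>g\<close>, although \<open>g\<close> carries the sign of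
    \<open>F0\<close>.\<close>
  have "is_weak_deriv {0<..} f g"
  proof -
    note W = loc_ac_is_weak_deriv[OF F]
    have "(\<integral>x. f x * deriv \<phi> x \<partial>\<mu>\<^sub>+) = (\<integral>x. F x * deriv \<phi> x \<partial>\<mu>\<^sub>+)" if t: "test_function {0<..} \<phi>" for \<phi>
    proof (rule integral_cong_AE)
      have "loc_int f" "loc_int F" using w W by (auto simp: is_weak_deriv_def Lp_loc_1_iff)
      then show "(\<lambda>x. f x * deriv \<phi> x) \<in> borel_measurable \<mu>\<^sub>+" "(\<lambda>x. F x * deriv \<phi> x) \<in> borel_measurable \<mu>\<^sub>+"
        using test_function_mult_integrable(2)[OF _ t] by (auto intro!: borel_measurable_integrable)
      show "AE x in \<mu>\<^sub>+. f x * deriv \<phi> x = F x * deriv \<phi> x" using fF by eventually_elim simp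
    qed
    then show ?thesis using w W by (auto simp: is_weak_deriv_def)
  qed
  then have wg: "AE r in \<mu>\<^sub>+. weak_deriv {0<..} f r = g r" by (rule weak_deriv_AE_eq)
  show ?thesis
  proof (rule that[OF F fF])
    show "0 \<le> F r" for r by (simp add: F_def)
    show "grad_energy p F g < \<infinity>" using X grad_energy_eq[OF fF wg, of p] by (simp add: Xp_def)
    fix G k assume G: "loc_ac G k" "grad_energy p G k < \<infinity>"
    have "Ip p f \<le> Ip p G" using m loc_ac_in_Xp[OF G p] by (simp add: nonneg_minimizer_def)
    then show "energy p F g \<le> energy p G k"
      unfolding Ip_eq_energy[OF fF wg] Ip_eq_energy[OF AE_I2 weak_deriv_AE_eq[OF loc_ac_is_weak_deriv[OF G(1)]], OF refl] .
  qed
qed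

section \<open>Ramps and their energy; the limit \<open>f_inf\<close> is the ramp of slope 1 / sqrt
  2\<close>

definition ramp :: "real \<Rightarrow> real \<Rightarrow> real" where
  "ramp a r = min (a * r) 1"

text \<open>The value \<open>a / 2\<close> at the kink is the one that \<open>loc_ac_min\<close>
  assigns to ties.\<close>

definition ramp_deriv :: "real \<Rightarrow> real \<Rightarrow> real" where
  "ramp_deriv a r = (if a * r < 1 then a else if 1 < a * r then 0 else a / 2)"

lemma loc_ac_ramp: "loc_ac (ramp a) (ramp_deriv a)"
proof -
  have "loc_ac (\<lambda>r. a * r) (\<lambda>r. a)"
    by (rule loc_ac_C1) (auto intro!: derivative_eq_intros continuous_intros)
  from loc_ac_min[OF this loc_ac_const[of 1]] show ?thesis
    by (rule loc_ac_cong) (auto simp: ramp_def ramp_deriv_def)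
qed

lemma nn_integral_Ioi_borel:
  fixes f :: "real \<Rightarrow> ennreal"
  shows "(\<integral>\<^sup>+r. f r \<partial>\<mu>\<^sub>+) = (\<integral>\<^sup>+r. f r * indicator {0<..} r \<partial>lborel)"
  by (subst nn_integral_restrict_space) (auto simp: nn_integral_completion)

lemma nn_integral_linear_Icc:
  fixes a b c :: real
  assumes "a \<le> b" "0 \<le> a" "0 \<le> c"
  shows "(\<integral>\<^sup>+r. ennreal (c * r) * indicator {a..b} r \<partial>lborel) = ennreal (c * (b\<^sup>2 - a\<^sup>2) / 2)"
proof -
  have "(\<integral>\<^sup>+r. ennreal (c * r) * indicator {a..b} r \<partial>lborel) = ennreal (c * b\<^sup>2 / 2 - c * a\<^sup>2 / 2)"
    by (rule nn_integral_FTC_Icc[of _ a b "\<lambda>r. c * r\<^sup>2 / 2"])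
      (use assms in \<open>auto intro!: derivative_eq_intros simp: has_real_derivative_iff_has_vector_derivative[symmetric]\<close>)
  then show ?thesis by (simp add: algebra_simps diff_divide_distrib)
qed

text \<open>On the linear piece \<open>g\<^sup>2 + F\<^sup>2 / r\<^sup>2\<close> equals
  \<open>2 * a\<^sup>2 = q\<close>, which contributes at most \<open>q powr (p / 2)\<close> times
  the weighted length \<open>1 / q\<close>. On the flat piece the density is
  \<open>r powr (1 - p)\<close>, integrable at infinity because \<open>p > 2\<close>.\<close>

lemma grad_energy_ramp:
  assumes p: "p > 2" and q: "0 < q" "q \<le> 1" and a: "a = sqrt (q / 2)"
  shows "grad_energy p (ramp a) (ramp_deriv a) \<le> ennreal (q powr (p / 2 - 1) * (1 + 1 / (p - 2)))"
proof -
  have a0: "a > 0" and a2: "2 * a\<^sup>2 = q" using q by (auto simp: a)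
  define f1 where "f1 r = ennreal (q powr (p/2) * r) * indicator {0..1/a} r" for r
  define f2 where "f2 r = ennreal (r powr (1 - p)) * indicator {1/a..} r" for r
  have "grad_energy p (ramp a) (ramp_deriv a) \<le> (\<integral>\<^sup>+r. f1 r + f2 r \<partial>lborel)"
    unfolding grad_energy_def nn_integral_Ioi_borel
  proof (rule nn_integral_mono)
    fix r :: real
    show "ennreal (grad_density p (ramp a) (ramp_deriv a) r) * indicator {0<..} r \<le> f1 r + f2 r"
    proof (cases "r > 0")
      case r: True
      show ?thesis
      proof (cases "a * r \<le> 1")
        case True
        have "(ramp_deriv a r)\<^sup>2 \<le> a\<^sup>2" 
          using True a0 by (auto simp: ramp_deriv_def power_divide)
        moreover have "(ramp a r)\<^sup>2 / r\<^sup>2 = a\<^sup>2" using True r by (simp add: ramp_def min_absorb1 power_mult_distrib)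
        ultimately have "((ramp_deriv a r)\<^sup>2 + (ramp a r)\<^sup>2 / r\<^sup>2) powr (p/2) \<le> q powr (p/2)"
          using p a2 by (intro powr_mono2) auto
        then have "ennreal (grad_density p (ramp a) (ramp_deriv a) r) \<le> ennreal (q powr (p/2) * r)"
          using r by (auto simp: grad_density_def intro!: mult_right_mono ennreal_leI)
        moreover have "r \<in> {0..1/a}" using True r a0 by (auto simp: field_simps)
        ultimately have "ennreal (grad_density p (ramp a) (ramp_deriv a) r) * indicator {0<..} r \<le> f1 r"
          using r by (simp add: f1_def)
        then show ?thesis by (rule add_increasing2[rotated]) simp
      next
        case False
        have "(1 / r\<^sup>2) powr (p/2) * r = r powr (1 - p)"
        proof -
          have "1 / r\<^sup>2 = r powr (-2)" using r by (simp add: powr_minus powr_numeral divide_inverse)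
          then have "(1 / r\<^sup>2) powr (p/2) * r = r powr (- p) * r powr 1" using r by (simp add: powr_powr)
          also have "\<dots> = r powr (1 - p)" by (simp only: powr_add[symmetric]) simp
          finally show ?thesis .
        qed
        then have "grad_density p (ramp a) (ramp_deriv a) r = r powr (1 - p)"
          using False by (simp add: grad_density_def ramp_def ramp_deriv_def)
        moreover have "r \<in> {1/a..}" using False a0 by (auto simp: field_simps)
        ultimately show ?thesis using r by (auto simp: f2_def)
      qed
    qed simp
  qed
  also have "\<dots> = (\<integral>\<^sup>+r. f1 r \<partial>lborel) + (\<integral>\<^sup>+r. f2 r \<partial>lborel)"
    by (rule nn_integral_add) (auto simp: f1_def f2_def)
  also have "(\<integral>\<^sup>+r. f1 r \<partial>lborel) = ennreal (q powr (p / 2 - 1))"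
  proof -
    have "(\<integral>\<^sup>+r. f1 r \<partial>lborel) = ennreal (q powr (p/2) * ((1/a)\<^sup>2 - 0\<^sup>2) / 2)"
      unfolding f1_def by (rule nn_integral_linear_Icc) (use a0 in auto)
    also have "q powr (p/2) * ((1/a)\<^sup>2 - 0\<^sup>2) / 2 = q powr (p / 2 - 1)"
      using a2 a0 q by (simp add: powr_diff power_divide)
    finally show ?thesis .
  qed
  also have "(\<integral>\<^sup>+r. f2 r \<partial>lborel) \<le> ennreal (q powr (p / 2 - 1) / (p - 2))"
  proof -
    have "(\<integral>\<^sup>+r. f2 r \<partial>lborel) = ennreal (0 - (- ((1/a) powr (2 - p) / (p - 2))))"
      unfolding f2_def
    proof (rule nn_integral_FTC_atLeast)
      fix x assume "1/a \<le> x"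
      then have x: "x > 0" using a0 by (meson divide_pos_pos less_le_trans zero_less_one)
      have "((\<lambda>x. - (x powr (2 - p) / (p - 2))) has_real_derivative
          - ((2 - p) * x powr (2 - p - 1) / (p - 2))) (at x)"
        using x by (intro DERIV_minus DERIV_cdivide has_real_derivative_powr)
      moreover have "- ((2 - p) * x powr (2 - p - 1) / (p - 2)) = x powr (1 - p)"
        using p by (simp add: field_simps)
      ultimately show "((\<lambda>x. - (x powr (2 - p) / (p - 2))) has_real_derivative x powr (1 - p)) (at x)"
        by simp
    next
      have "((\<lambda>x. x powr (2 - p)) \<longlongrightarrow> 0) at_top"
        using p by (intro tendsto_neg_powr filterlim_ident) auto
      then have "((\<lambda>x. - (x powr (2 - p) / (p - 2))) \<longlongrightarrow> - (0 / (p - 2))) at_top"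
        using p by (intro tendsto_intros) auto
      then show "((\<lambda>x. - (x powr (2 - p) / (p - 2))) \<longlongrightarrow> 0) at_top" by simp
    qed auto
    also have "(1/a) powr (2 - p) = (q / 2) powr (p / 2 - 1)"
    proof -
      have "a = (q / 2) powr (1 / 2)" using q by (simp add: a powr_half_sqrt)
      then have "1 / a = (q / 2) powr (- (1 / 2))" by (simp add: powr_minus_divide)
      then have "(1/a) powr (2 - p) = (q / 2) powr (- (1 / 2) * (2 - p))" by (simp only: powr_powr)
      also have "- (1 / 2) * (2 - p) = p / 2 - 1" by (simp add: field_simps)
      finally show ?thesis .
    qed
    also have "ennreal (0 - (- ((q / 2) powr (p / 2 - 1) / (p - 2)))) \<le> ennreal (q powr (p / 2 - 1) / (p - 2))"
      using p q by (intro ennreal_leI) (auto intro!: divide_right_mono powr_mono2)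
    finally show ?thesis .
  qed
  also have "ennreal (q powr (p / 2 - 1)) + ennreal (q powr (p / 2 - 1) / (p - 2))
     = ennreal (q powr (p / 2 - 1) * (1 + 1 / (p - 2)))"
    using p by (subst ennreal_plus[symmetric]) (auto simp: algebra_simps)
  finally show ?thesis by simp
qed

text \<open>The potential vanishes beyond \<open>1 / a\<close> and is at most \<open>r / 2\<close>
  before, which adds \<open>1 / (2 * q)\<close>.\<close>

lemma energy_ramp:
  assumes p: "p > 2" and q: "0 < q" "q \<le> 1" and a: "a = sqrt (q / 2)"
  shows "energy p (ramp a) (ramp_deriv a)
    \<le> ennreal (q powr (p / 2 - 1) * (1 + 1 / (p - 2)) + 1 / (2 * q))"
proof -
  have a0: "a > 0" and a2: "2 * a\<^sup>2 = q" using q by (auto simp: a)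
  note [measurable] = loc_ac_measurable[OF loc_ac_ramp[of a]]
  have "energy p (ramp a) (ramp_deriv a) = (\<integral>\<^sup>+r. ennreal (grad_density p (ramp a) (ramp_deriv a) r) + 
     ennreal (1 / 2 * (1 - (ramp a r)\<^sup>2)\<^sup>2 * r) \<partial>\<mu>\<^sub>+)"
    unfolding energy_def
    by (rule nn_integral_cong_AE, use AE_Ioi in eventually_elim) (simp add: grad_density_nonneg)
  also have "\<dots> = grad_energy p (ramp a) (ramp_deriv a) + (\<integral>\<^sup>+r. ennreal (1 / 2 * (1 - (ramp a r)\<^sup>2)\<^sup>2 * r) \<partial>\<mu>\<^sub>+)"
    unfolding grad_energy_def by (rule nn_integral_add) measurable
  also have "(\<integral>\<^sup>+r. ennreal (1 / 2 * (1 - (ramp a r)\<^sup>2)\<^sup>2 * r) \<partial>\<mu>\<^sub>+)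
    \<le> (\<integral>\<^sup>+r. ennreal (1 / 2 * r) * indicator {0..1/a} r \<partial>lborel)"
    unfolding nn_integral_Ioi_borel
  proof (rule nn_integral_mono)
    fix r :: real
    show "ennreal (1 / 2 * (1 - (ramp a r)\<^sup>2)\<^sup>2 * r) * indicator {0<..} r
      \<le> ennreal (1 / 2 * r) * indicator {0..1/a} r"
    proof (cases "0 < r \<and> a * r \<le> 1")
      case True
      then have "(ramp a r)\<^sup>2 \<le> 1" using a0 by (auto simp: ramp_def abs_square_le_1)
      then have "(1 - (ramp a r)\<^sup>2)\<^sup>2 \<le> 1" by (simp add: abs_square_le_1)
      then have "1 / 2 * (1 - (ramp a r)\<^sup>2)\<^sup>2 * r \<le> 1 / 2 * r" using True by simp
      moreover have "r \<in> {0..1/a}" using True a0 by (auto simp: field_simps)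
      ultimately show ?thesis using True by (auto intro!: ennreal_leI)
    next
      case False
      then show ?thesis by (auto simp: ramp_def indicator_def)
    qed
  qed
  also have "\<dots> = ennreal (1 / 2 * ((1/a)\<^sup>2 - 0\<^sup>2) / 2)"
    by (rule nn_integral_linear_Icc) (use a0 in auto)
  also have "1 / 2 * ((1/a)\<^sup>2 - 0\<^sup>2) / 2 = 1 / (2 * q)"
    using a2 by (simp add: power_divide)
  also have "grad_energy p (ramp a) (ramp_deriv a) \<le> ennreal (q powr (p / 2 - 1) * (1 + 1 / (p - 2)))"
    by (rule grad_energy_ramp[OF p q a])
  also have "ennreal (q powr (p / 2 - 1) * (1 + 1 / (p - 2))) + ennreal (1 / (2 * q))
    = ennreal (q powr (p / 2 - 1) * (1 + 1 / (p - 2)) + 1 / (2 * q))"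
    using p q by (subst ennreal_plus) auto
  finally show ?thesis by (simp add: add_mono)
qed

section \<open>Comparison arguments\<close>

text \<open>Minimality restated for a non-negative representative against absolutely continuous
  competitors, so that the comparison arguments never meet a weak derivative.\<close>

locale energy_minimizer =
  fixes p :: real and F g :: "real \<Rightarrow> real"
  assumes p: "p > 2" and F: "loc_ac F g" and F_nonneg: "\<And>r. 0 \<le> F r"
    and grad_fin: "grad_energy p F g < \<infinity>"
    and minimal: "\<And>G k. loc_ac G k \<Longrightarrow> grad_energy p G k < \<infinity> \<Longrightarrow> energy p F g \<le> energy p G k"
begin

lemmas F_measurable [measurable] = loc_ac_measurable[OF F]

lemma energy_le_ramp:
  assumes q: "0 < q" "q \<le> 1"
  shows "energy p F g \<le> ennreal (q powr (p / 2 - 1) * (1 + 1 / (p - 2)) + 1 / (2 * q))"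
proof -
  have "grad_energy p (ramp (sqrt (q / 2))) (ramp_deriv (sqrt (q / 2))) < \<infinity>"
    using grad_energy_ramp[OF p q refl] by (rule le_less_trans) simp
  from order_trans[OF minimal[OF loc_ac_ramp this] energy_ramp[OF p q refl]] show ?thesis .
qed

lemma energy_finite: "energy p F g < \<infinity>"
  using energy_le_ramp[of 1] by (rule le_less_trans) auto

text \<open>Here \<open>R\<close> is what the competitor gains and \<open>T\<close> what it costs,
  both as pointwise densities; minimality says that the total gain cannot exceed the total
  cost.\<close>

lemma comparison:
  assumes G: "loc_ac G k" and finG: "grad_energy p G k < \<infinity>"
    and m[measurable]: "R \<in> borel_measurable \<mu>\<^sub>+" "T \<in> borel_measurable \<mu>\<^sub>+"
    and nonneg: "\<And>r. 0 < r \<Longrightarrow> 0 \<le> R r" "\<And>r. 0 < r \<Longrightarrow> 0 \<le> T r"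
    and le: "\<And>r. 0 < r \<Longrightarrow> grad_density p G k r + 1 / 2 * (1 - (G r)\<^sup>2)\<^sup>2 * r + R r
      \<le> grad_density p F g r + 1 / 2 * (1 - (F r)\<^sup>2)\<^sup>2 * r + T r"
  shows "(\<integral>\<^sup>+r. ennreal (R r) \<partial>\<mu>\<^sub>+) \<le> (\<integral>\<^sup>+r. ennreal (T r) \<partial>\<mu>\<^sub>+)"
proof -
  note [measurable] = loc_ac_measurable[OF G]
  let ?iF = "\<lambda>r. grad_density p F g r + 1 / 2 * (1 - (F r)\<^sup>2)\<^sup>2 * r"
  let ?iG = "\<lambda>r. grad_density p G k r + 1 / 2 * (1 - (G r)\<^sup>2)\<^sup>2 * r"
  have "energy p F g + (\<integral>\<^sup>+r. ennreal (R r) \<partial>\<mu>\<^sub>+) \<le> energy p G k + (\<integral>\<^sup>+r. ennreal (R r) \<partial>\<mu>\<^sub>+)"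
    by (intro add_mono minimal[OF G finG] order_refl)
  also have "\<dots> = (\<integral>\<^sup>+r. ennreal (?iG r) + ennreal (R r) \<partial>\<mu>\<^sub>+)"
    unfolding energy_def by (rule nn_integral_add[symmetric]) measurable
  also have "\<dots> \<le> (\<integral>\<^sup>+r. ennreal (?iF r) + ennreal (T r) \<partial>\<mu>\<^sub>+)"
  proof (rule nn_integral_mono_AE, use AE_Ioi in eventually_elim)
    case (elim r)
    have "ennreal (?iG r) + ennreal (R r) = ennreal (?iG r + R r)"
      using elim nonneg(1)[OF elim] by (intro ennreal_plus[symmetric] add_nonneg_nonneg grad_density_nonneg) auto
    also have "\<dots> \<le> ennreal (?iF r + T r)" by (rule ennreal_leI[OF le[OF elim]])
    also have "\<dots> = ennreal (?iF r) + ennreal (T r)"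
      using elim nonneg(2)[OF elim] by (intro ennreal_plus add_nonneg_nonneg grad_density_nonneg) auto
    finally show ?case .
  qed
  also have "\<dots> = energy p F g + (\<integral>\<^sup>+r. ennreal (T r) \<partial>\<mu>\<^sub>+)"
    unfolding energy_def by (rule nn_integral_add) measurable
  \<comment> \<open>In \<open>ennreal\<close> the common term may be cancelled only because the
    energy of the minimizer is finite.\<close>
  finally show ?thesis using energy_finite by (auto simp: ennreal_add_left_cancel_le)
qed

text \<open>Truncation at 1 costs nothing in the gradient and gains the whole potential where
  \<open>F\<close> exceeds 1, so that set must be null.\<close>

lemma AE_le_1: "AE r in \<mu>\<^sub>+. F r \<le> 1"
proof -
  define k where "k r = (if F r < 1 then g r else if 1 < F r then 0 else (g r + 0) / 2)" for r
  define G where "G r = min (F r) 1" for r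
  have G: "loc_ac G k" unfolding G_def k_def by (rule loc_ac_min[OF F loc_ac_const])
  have dens: "grad_density p G k r \<le> grad_density p F g r" if "r > 0" for r
  proof -
    have "(k r)\<^sup>2 \<le> (g r)\<^sup>2" by (auto simp: k_def power_divide)
    moreover have "(G r)\<^sup>2 \<le> (F r)\<^sup>2" using F_nonneg[of r] by (intro power_mono) (auto simp: G_def)
    ultimately have "((k r)\<^sup>2 + (G r)\<^sup>2 / r\<^sup>2) powr (p / 2) \<le> ((g r)\<^sup>2 + (F r)\<^sup>2 / r\<^sup>2) powr (p / 2)"
      using p by (intro powr_mono2 add_mono divide_right_mono) auto
    then show ?thesis using that by (auto simp: grad_density_def intro!: mult_right_mono)
  qed
  have fin: "grad_energy p G k < \<infinity>"
  proof -
    have "grad_energy p G k \<le> grad_energy p F g" unfolding grad_energy_def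
      by (rule nn_integral_mono_AE, use AE_Ioi in eventually_elim) (intro ennreal_leI dens)
    then show ?thesis using grad_fin by (rule le_less_trans)
  qed
  define R where "R r = (if F r \<le> 1 then 0 else 1 / 2 * (1 - (F r)\<^sup>2)\<^sup>2 * r)" for r
  have [measurable]: "R \<in> borel_measurable \<mu>\<^sub>+" unfolding R_def[abs_def] by measurable
  have "(\<integral>\<^sup>+r. ennreal (R r) \<partial>\<mu>\<^sub>+) \<le> (\<integral>\<^sup>+r. ennreal 0 \<partial>\<mu>\<^sub>+)"
  proof (rule comparison[OF G fin])
    fix r :: real assume r: "0 < r"
    show "0 \<le> R r" using r by (auto simp: R_def)
    show "grad_density p G k r + 1 / 2 * (1 - (G r)\<^sup>2)\<^sup>2 * r + R r
      \<le> grad_density p F g r + 1 / 2 * (1 - (F r)\<^sup>2)\<^sup>2 * r + 0"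
      using dens[OF r] by (auto simp: R_def G_def)
  qed auto
  then have "(\<integral>\<^sup>+r. ennreal (R r) \<partial>\<mu>\<^sub>+) = 0" by simp
  then have "AE r in \<mu>\<^sub>+. ennreal (R r) = 0"
    using nn_integral_0_iff_AE[of "\<lambda>r. ennreal (R r)" "\<mu>\<^sub>+"] by simp
  then show ?thesis using AE_Ioi
  proof eventually_elim
    case (elim r)
    show ?case
    proof (rule ccontr)
      assume "\<not> F r \<le> 1"
      then have "1 < (F r)\<^sup>2" by (simp add: one_less_power)
      then have "(1 - (F r)\<^sup>2)\<^sup>2 * r > 0" using elim(2) by (intro mult_pos_pos) auto
      then have "R r > 0" using \<open>\<not> F r \<le> 1\<close> by (simp add: R_def)
      then show False using elim(1) by (simp add: ennreal_eq_0_iff)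
    qed
  qed
qed

text \<open>Raising \<open>F\<close> to the ramp changes it only where it lies below. There the
  gradient density becomes that of the ramp, while the potential drops by at least half the squared
  deficit of the squares.\<close>

lemma ramp_deficit_integral:
  assumes q: "0 < q" "q \<le> 1" and a: "a = sqrt (q / 2)"
  shows "(\<integral>\<^sup>+r. ennreal (1 / 2 * (max 0 ((ramp a r)\<^sup>2 - (F r)\<^sup>2))\<^sup>2 * r) \<partial>\<mu>\<^sub>+)
    \<le> grad_energy p (ramp a) (ramp_deriv a)"
proof -
  note ramp_m [measurable] = loc_ac_measurable[OF loc_ac_ramp[of a]]
  have a0: "a > 0" using q a by simp
  define k where "k r = (if F r < ramp a r then ramp_deriv a r else if ramp a r < F r then g r
     else (g r + ramp_deriv a r) / 2)" for r
  define G where "G r = max (F r) (ramp a r)" for r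
  have G: "loc_ac G k" unfolding G_def k_def by (rule loc_ac_max[OF F loc_ac_ramp])
  let ?dF = "\<lambda>r. grad_density p F g r" and ?dR = "\<lambda>r. grad_density p (ramp a) (ramp_deriv a) r"
  have dens_mono: "grad_density p H h r \<le> grad_density p H' h' r"
    if "r > 0" "(h r)\<^sup>2 \<le> (h' r)\<^sup>2" "(H r)\<^sup>2 = (H' r)\<^sup>2" for H h H' h' r
    using that p by (auto simp: grad_density_def intro!: mult_right_mono powr_mono2)
  have dens: "grad_density p G k r \<le> (if F r \<le> ramp a r then ?dF r + ?dR r else ?dF r)" if r: "r > 0" for r
  proof (cases "F r" "ramp a r" rule: linorder_cases)
    case less
    then have "grad_density p G k r = ?dR r" by (simp add: grad_density_def G_def k_def)
    then show ?thesis using less grad_density_nonneg[OF r, of p F g] by simp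
  next
    case greater
    then show ?thesis by (simp add: grad_density_def G_def k_def)
  next
    case equal
    \<comment> \<open>On ties \<open>k\<close> averages the two derivatives, so its size is bounded
      by the larger of theirs.\<close>
    have "\<bar>k r\<bar> \<le> max \<bar>g r\<bar> \<bar>ramp_deriv a r\<bar>" using equal by (auto simp: k_def)
    then consider "\<bar>k r\<bar> \<le> \<bar>g r\<bar>" | "\<bar>k r\<bar> \<le> \<bar>ramp_deriv a r\<bar>" by linarith
    then have "grad_density p G k r \<le> ?dF r \<or> grad_density p G k r \<le> ?dR r"
    proof cases
      case 1
      then have "grad_density p G k r \<le> ?dF r"
        using equal by (intro dens_mono r) (auto simp: G_def abs_le_square_iff)
      then show ?thesis ..
    next
      case 2
      then have "grad_density p G k r \<le> ?dR r"
        using equal by (intro dens_mono r) (auto simp: G_def abs_le_square_iff)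
      then show ?thesis ..
    qed
    then show ?thesis
      using equal grad_density_nonneg[OF r, of p F g]
        grad_density_nonneg[OF r, of p "ramp a" "ramp_deriv a"] by auto
  qed
  have fin: "grad_energy p G k < \<infinity>"
  proof -
    have "grad_energy p G k \<le> (\<integral>\<^sup>+r. ennreal (?dF r) + ennreal (?dR r) \<partial>\<mu>\<^sub>+)" unfolding grad_energy_def
    proof (rule nn_integral_mono_AE, use AE_Ioi in eventually_elim)
      case (elim r)
      have "grad_density p G k r \<le> ?dF r + ?dR r"
        using dens[OF elim] grad_density_nonneg[OF elim, of p "ramp a" "ramp_deriv a"] by (auto split: if_splits)
      then have "ennreal (grad_density p G k r) \<le> ennreal (?dF r + ?dR r)" by (rule ennreal_leI)
      then show ?case using elim by (simp add: grad_density_nonneg)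
    qed
    also have "\<dots> = grad_energy p F g + grad_energy p (ramp a) (ramp_deriv a)"
      unfolding grad_energy_def by (rule nn_integral_add) measurable
    also have "\<dots> < \<infinity>"
      using grad_fin le_less_trans[OF grad_energy_ramp[OF p q a], of \<infinity>] by simp
    finally show ?thesis .
  qed
  have "(\<integral>\<^sup>+r. ennreal (1 / 2 * (max 0 ((ramp a r)\<^sup>2 - (F r)\<^sup>2))\<^sup>2 * r) \<partial>\<mu>\<^sub>+) \<le> (\<integral>\<^sup>+r. ennreal (?dR r) \<partial>\<mu>\<^sub>+)"
  proof (rule comparison[OF G fin])
    fix r :: real assume r: "0 < r"
    show "0 \<le> ?dR r" using r by (rule grad_density_nonneg)
    show "grad_density p G k r + 1 / 2 * (1 - (G r)\<^sup>2)\<^sup>2 * r + 1 / 2 * (max 0 ((ramp a r)\<^sup>2 - (F r)\<^sup>2))\<^sup>2 * r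
      \<le> ?dF r + 1 / 2 * (1 - (F r)\<^sup>2)\<^sup>2 * r + ?dR r"
    proof (cases "F r \<le> ramp a r")
      case True
      have sq: "(F r)\<^sup>2 \<le> (ramp a r)\<^sup>2" using True F_nonneg by (intro power_mono)
      have "(ramp a r)\<^sup>2 \<le> 1" using a0 r by (auto simp: ramp_def abs_square_le_1 min_def)
      \<comment> \<open>The cross term in the expansion of
        \<open>(1 - (F r)\<^sup>2)\<^sup>2\<close>, with \<open>1 - (F r)\<^sup>2\<close> split at
        the square of the ramp; dropping it leaves the sum of the two squares.\<close>
      then have "0 \<le> ((ramp a r)\<^sup>2 - (F r)\<^sup>2) * (1 - (ramp a r)\<^sup>2)" using sq by simp
      then have "(1 - (ramp a r)\<^sup>2)\<^sup>2 + ((ramp a r)\<^sup>2 - (F r)\<^sup>2)\<^sup>2 \<le> (1 - (F r)\<^sup>2)\<^sup>2"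
        by (simp add: power2_eq_square algebra_simps)
      then have "1 / 2 * ((1 - (ramp a r)\<^sup>2)\<^sup>2 + ((ramp a r)\<^sup>2 - (F r)\<^sup>2)\<^sup>2) * r \<le> 1 / 2 * (1 - (F r)\<^sup>2)\<^sup>2 * r"
        using r by simp
      moreover have "max 0 ((ramp a r)\<^sup>2 - (F r)\<^sup>2) = (ramp a r)\<^sup>2 - (F r)\<^sup>2" using sq by simp
      moreover have "G r = ramp a r" using True by (simp add: G_def)
      ultimately show ?thesis using dens[OF r] True by (simp add: algebra_simps)
    next
      case False
      then have "(ramp a r)\<^sup>2 \<le> (F r)\<^sup>2" using a0 r by (intro power_mono) (auto simp: ramp_def)
      then show ?thesis
        using False dens[OF r] grad_density_nonneg[OF r, of p "ramp a" "ramp_deriv a"] by (simp add: G_def)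
    qed
  qed auto
  then show ?thesis by (simp add: grad_energy_def)
qed

section \<open>Pointwise consequences of the energy bound\<close>

lemma grad_density_integral:
  assumes M: "grad_energy p F g \<le> ennreal M" "0 \<le> M" and ab: "0 < a" "a \<le> b"
  shows "grad_density p F g integrable_on {a..b}" "integral {a..b} (grad_density p F g) \<le> M"
proof -
  let ?W = "grad_density p F g"
  have nn: "0 \<le> ?W r" if "r \<in> {0<..}" for r using that by (auto intro: grad_density_nonneg)
  have i: "integrable \<mu>\<^sub>+ ?W"
  proof (rule integrableI_nonneg)
    show "AE r in \<mu>\<^sub>+. 0 \<le> ?W r" using AE_Ioi by eventually_elim (rule grad_density_nonneg)
    show "(\<integral>\<^sup>+r. ennreal (?W r) \<partial>\<mu>\<^sub>+) < \<infinity>" using grad_fin by (simp add: grad_energy_def)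
  qed measurable
  have iI: "?W integrable_on {0<..}" by (rule integrable_on_lebesgue_on[OF i]) simp
  have "?W absolutely_integrable_on {0<..}" using iI nn by (intro nonnegative_absolutely_integrable_1) auto
  then have "?W absolutely_integrable_on {a..b}" by (rule set_integrable_subset) (use ab in auto)
  then show iab: "?W integrable_on {a..b}" by (simp add: absolutely_integrable_on_def)
  have "integral {a..b} ?W \<le> integral {0<..} ?W"
    by (rule integral_subset_le) (use ab iab iI nn in auto)
  also have "\<dots> = (\<integral>r. ?W r \<partial>\<mu>\<^sub>+)" by (rule lebesgue_integral_eq_integral[OF i, symmetric]) simp
  also have "\<dots> \<le> M"
  proof -
    have "ennreal (\<integral>r. ?W r \<partial>\<mu>\<^sub>+) = (\<integral>\<^sup>+r. ennreal (?W r) \<partial>\<mu>\<^sub>+)"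
      using AE_Ioi by (intro nn_integral_eq_integral[symmetric] i) (auto elim!: eventually_mono intro: grad_density_nonneg)
    also have "\<dots> \<le> ennreal M" using M by (simp add: grad_energy_def)
    finally show ?thesis using M(2) by (simp add: ennreal_le_iff)
  qed
  finally show "integral {a..b} ?W \<le> M" .
qed

text \<open>The derivative \<open>2 * F r * g r\<close> is at most \<open>r * e\<close> by the
  arithmetic-geometric mean inequality, where \<open>e\<close> is the sum of squares in the density.
  Where \<open>e\<close> is below \<open>L\<close> it grows at the limiting rate up to the factor
  \<open>L\<close>; the remaining part is charged to the gradient energy.\<close>

lemma square_growth:
  assumes M: "grad_energy p F g \<le> ennreal M" "0 \<le> M" and ab: "0 < a" "a \<le> b" and L: "L > 0"
  shows "\<bar>(F b)\<^sup>2 - (F a)\<^sup>2\<bar> \<le> L * (b\<^sup>2 - a\<^sup>2) / 2 + L powr (1 - p / 2) * M"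
proof -
  let ?W = "grad_density p F g" and ?c = "L powr (1 - p / 2)"
  note W = grad_density_integral[OF M ab]
  note sq = loc_acD[OF loc_ac_square[OF F] ab]
  have lin: "((\<lambda>r. L * r) has_integral L * b\<^sup>2 / 2 - L * a\<^sup>2 / 2) {a..b}"
    by (rule fundamental_theorem_of_calculus[OF ab(2)])
      (auto intro!: derivative_eq_intros simp: has_real_derivative_iff_has_vector_derivative[symmetric])
  have pw: "norm (2 * F r * g r) \<le> L * r + ?c * ?W r" if "r \<in> {a..b}" for r
  proof -
    have r: "r > 0" using that ab by auto
    define e where "e = (g r)\<^sup>2 + (F r)\<^sup>2 / r\<^sup>2"
    have e0: "e \<ge> 0" by (simp add: e_def)
    have "\<bar>2 * F r * g r\<bar> = r * (2 * \<bar>g r\<bar> * (\<bar>F r\<bar> / r))" using r by (simp add: abs_mult)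
    also have "\<dots> \<le> r * e"
    proof (rule mult_left_mono)
      have "0 \<le> (\<bar>g r\<bar> - \<bar>F r\<bar> / r)\<^sup>2" by simp
      then show "2 * \<bar>g r\<bar> * (\<bar>F r\<bar> / r) \<le> e" by (simp add: e_def power2_diff power_divide)
    qed (use r in simp)
    also have "\<dots> \<le> r * (L + ?c * e powr (p / 2))"
    proof (rule mult_left_mono)
      show "e \<le> L + ?c * e powr (p / 2)"
      proof (cases "e \<le> L")
        case False
        then have e: "e > 0" using L by linarith
        \<comment> \<open>The exponent \<open>1 - p / 2\<close> is negative, so replacing
          \<open>e\<close> by the smaller \<open>L\<close> increases the first factor.\<close>
        have "e = e powr (1 - p / 2) * e powr (p / 2)" using e by (simp add: powr_add[symmetric])
        also have "\<dots> \<le> ?c * e powr (p / 2)"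
          using False L p by (intro mult_right_mono powr_mono2') auto
        finally show ?thesis using L by simp
      qed (use L in \<open>simp add: add_increasing2\<close>)
    qed (use r in simp)
    also have "\<dots> = L * r + ?c * ?W r" by (simp add: grad_density_def e_def algebra_simps)
    finally show ?thesis by simp
  qed
  have "\<bar>(F b)\<^sup>2 - (F a)\<^sup>2\<bar> = norm (integral {a..b} (\<lambda>r. 2 * F r * g r))" using sq(4) by simp
  also have "\<dots> \<le> integral {a..b} (\<lambda>r. L * r + ?c * ?W r)"
    by (rule integral_norm_bound_integral[OF sq(3) _ pw])
      (intro integrable_add has_integral_integrable[OF lin] integrable_on_mult_right W(1))
  also have "\<dots> = integral {a..b} (\<lambda>r. L * r) + integral {a..b} (\<lambda>r. ?c * ?W r)"
    by (intro integral_add has_integral_integrable[OF lin] integrable_on_mult_right W(1))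
  also have "\<dots> = (L * b\<^sup>2 / 2 - L * a\<^sup>2 / 2) + ?c * integral {a..b} ?W"
    using integral_unique[OF lin] by simp
  also have "\<dots> \<le> (L * b\<^sup>2 / 2 - L * a\<^sup>2 / 2) + ?c * M"
    by (intro add_left_mono mult_left_mono W(2)) simp
  finally show ?thesis by (simp add: algebra_simps diff_divide_distrib)
qed

text \<open>Otherwise \<open>F\<^sup>2 / r\<^sup>2\<close> exceeds
  \<open>\<epsilon> / (4 * t\<^sup>2)\<close> on \<open>{t..2*t}\<close>, and the gradient energy
  there is at least \<open>\<epsilon>\<^sup>2 / (16 * t\<^sup>2)\<close>, unbounded as t tends to
  0.\<close>

lemma square_small_near_0:
  assumes M: "grad_energy p F g \<le> ennreal M" "0 \<le> M" and p4: "p \<ge> 4" and e: "\<epsilon> > 0"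
  shows "\<exists>r. 0 < r \<and> r < \<epsilon> \<and> (F r)\<^sup>2 \<le> \<epsilon>"
proof (rule ccontr)
  assume "\<not> ?thesis"
  then have big: "(F r)\<^sup>2 > \<epsilon>" if "0 < r" "r < \<epsilon>" for r using that by force
  have "((\<lambda>t::real. 16 * t\<^sup>2 * M) \<longlongrightarrow> 16 * 0\<^sup>2 * M) (at_right 0)"
    "((\<lambda>t::real. 4 * t\<^sup>2) \<longlongrightarrow> 4 * 0\<^sup>2) (at_right 0)" "((\<lambda>t::real. 2 * t) \<longlongrightarrow> 2 * 0) (at_right 0)"
    by (intro tendsto_intros)+
  then have "eventually (\<lambda>t. 16 * t\<^sup>2 * M < \<epsilon>\<^sup>2) (at_right 0)" "eventually (\<lambda>t. 4 * t\<^sup>2 < \<epsilon>) (at_right 0)"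
    "eventually (\<lambda>t. 2 * t < \<epsilon>) (at_right 0)"
    using e by (auto intro!: order_tendstoD(2)[where y = 0])
  then have "eventually (\<lambda>t. 16 * t\<^sup>2 * M < \<epsilon>\<^sup>2 \<and> 4 * t\<^sup>2 < \<epsilon> \<and> 2 * t < \<epsilon> \<and> 0 < t) (at_right 0)"
    using eventually_at_right_less by eventually_elim auto
  then obtain t where t: "16 * t\<^sup>2 * M < \<epsilon>\<^sup>2" "4 * t\<^sup>2 < \<epsilon>" "2 * t < \<epsilon>" "0 < t"
    using eventually_happens' trivial_limit_at_right_real by (metis (no_types, lifting))
  \<comment> \<open>With \<open>y \<ge> 1\<close> and \<open>p \<ge> 4\<close> the power
    \<open>p / 2\<close> can be lowered to 2, which makes the bound independent of
    \<open>p\<close>.\<close>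
  define y where "y = \<epsilon> / (4 * t\<^sup>2)"
  have y: "y \<ge> 1" using t by (simp add: y_def)
  have ab: "0 < t" "t \<le> 2 * t" using t by auto
  note W = grad_density_integral[OF M ab]
  have "y\<^sup>2 * t \<le> grad_density p F g r" if "r \<in> {t..2*t}" for r
  proof -
    have r: "0 < r" "t \<le> r" "r \<le> 2 * t" "r < \<epsilon>" using that t by auto
    have "y \<le> (F r)\<^sup>2 / r\<^sup>2"
    proof -
      have "r\<^sup>2 \<le> (2 * t)\<^sup>2" using r by (intro power_mono) auto
      then have "\<epsilon> / (2 * t)\<^sup>2 \<le> (F r)\<^sup>2 / r\<^sup>2" using big[of r] r e by (intro frac_le) auto
      then show ?thesis by (simp add: y_def power_mult_distrib)
    qed
    then have ye: "y \<le> (g r)\<^sup>2 + (F r)\<^sup>2 / r\<^sup>2" by (simp add: add_increasing)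
    have "y\<^sup>2 = y powr 2" using y by simp
    also have "\<dots> \<le> y powr (p / 2)" using y p4 by (intro powr_mono) auto
    also have "\<dots> \<le> ((g r)\<^sup>2 + (F r)\<^sup>2 / r\<^sup>2) powr (p / 2)" using ye y p4 by (intro powr_mono2) auto
    finally show ?thesis using r t unfolding grad_density_def by (intro mult_mono) auto
  qed
  then have "integral {t..2*t} (\<lambda>r. y\<^sup>2 * t) \<le> integral {t..2*t} (grad_density p F g)"
    by (intro integral_le W) auto
  also have "\<dots> \<le> M" by (rule W)
  finally have "y\<^sup>2 * t\<^sup>2 \<le> M" using t by (simp add: power2_eq_square mult_ac)
  moreover have "y\<^sup>2 * t\<^sup>2 * (16 * t\<^sup>2) = \<epsilon>\<^sup>2" using t by (simp add: y_def field_simps power2_eq_square)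
  ultimately have "\<epsilon>\<^sup>2 \<le> M * (16 * t\<^sup>2)" by (metis mult_right_mono zero_le_power2 mult_nonneg_nonneg zero_le_numeral)
  then show False using t(1) by (simp add: mult_ac)
qed

text \<open>Apply \<open>square_growth\<close> from points \<open>t\<close> near 0 at which
  \<open>F\<^sup>2\<close> is arbitrarily small.\<close>

lemma square_upper:
  assumes M: "grad_energy p F g \<le> ennreal M" "0 \<le> M" and p4: "p \<ge> 4" and r: "0 < r" and L: "L > 0"
  shows "(F r)\<^sup>2 \<le> L * r\<^sup>2 / 2 + L powr (1 - p / 2) * M"
proof (rule field_le_epsilon)
  fix e :: real assume "e > 0"
  then obtain t where t: "0 < t" "t < min e r" "(F t)\<^sup>2 \<le> min e r"
    using square_small_near_0[OF M p4, of "min e r"] r by auto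
  have "(F r)\<^sup>2 - (F t)\<^sup>2 \<le> L * (r\<^sup>2 - t\<^sup>2) / 2 + L powr (1 - p / 2) * M"
    using square_growth[OF M t(1) _ L, of r] t(2) by auto
  also have "\<dots> \<le> L * r\<^sup>2 / 2 + L powr (1 - p / 2) * M"
    using L by (auto intro!: divide_right_mono mult_left_mono)
  finally show "(F r)\<^sup>2 \<le> L * r\<^sup>2 / 2 + L powr (1 - p / 2) * M + e" using t(3) by simp
qed

text \<open>A deficit at one point spreads to an interval: the ramp increases while
  \<open>F\<^sup>2\<close> grows at a controlled rate. The integrated deficit then bounds its
  supremum, with the unavoidable jump of \<open>square_growth\<close> already subtracted in
  \<eta>.\<close>

lemma ramp_deficit_sup:
  assumes M: "grad_energy p F g \<le> ennreal M" "0 \<le> M" and r: "0 < r" and L: "L > 0"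
    and q: "0 < q" "q \<le> 1" and a: "a = sqrt (q / 2)"
    and \<eta>: "\<eta> = (ramp a r)\<^sup>2 - (F r)\<^sup>2 - L powr (1 - p / 2) * M" "\<eta> > 0"
  shows "\<eta> ^ 3 / (16 * L) \<le> q powr (p / 2 - 1) * (1 + 1 / (p - 2))"
proof -
  have a0: "a > 0" using q a by simp
  \<comment> \<open>Up to \<open>s\<close> the linear growth of \<open>F\<^sup>2\<close> uses
    exactly \<eta> / 2, so at least \<eta> / 2 of the deficit remains on
    \<open>{r..s}\<close>.\<close>
  define s where "s = sqrt (r\<^sup>2 + \<eta> / L)"
  have s2: "s\<^sup>2 = r\<^sup>2 + \<eta> / L" using \<eta>(2) L by (simp add: s_def)
  have "0 \<le> s" using \<eta>(2) L by (simp add: s_def)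
  moreover have "r\<^sup>2 \<le> s\<^sup>2" unfolding s2 using \<eta>(2) L by simp
  ultimately have rs: "r \<le> s" by (rule power2_le_imp_le[rotated])
  have D: "\<eta> / 2 \<le> max 0 ((ramp a t)\<^sup>2 - (F t)\<^sup>2)" if t: "t \<in> {r..s}" for t
  proof -
    have "t\<^sup>2 \<le> s\<^sup>2" using t r by (intro power_mono) auto
    then have "L * (t\<^sup>2 - r\<^sup>2) / 2 \<le> \<eta> / 2" using s2 L by (simp add: field_simps)
    moreover have "(F t)\<^sup>2 - (F r)\<^sup>2 \<le> L * (t\<^sup>2 - r\<^sup>2) / 2 + L powr (1 - p / 2) * M"
      using square_growth[OF M r _ L, of t] t by auto
    moreover have "(ramp a r)\<^sup>2 \<le> (ramp a t)\<^sup>2"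
    proof (rule power_mono)
      show "ramp a r \<le> ramp a t"
        unfolding ramp_def using t a0 by (intro min.mono mult_left_mono) auto
      show "0 \<le> ramp a r" using a0 r by (simp add: ramp_def)
    qed
    ultimately have "\<eta> / 2 \<le> (ramp a t)\<^sup>2 - (F t)\<^sup>2" using \<eta>(1) by linarith
    then show ?thesis by (rule max.coboundedI2)
  qed
  have "ennreal (\<eta> ^ 3 / (16 * L)) = ennreal (\<eta>\<^sup>2 / 8 * (s\<^sup>2 - r\<^sup>2) / 2)"
    unfolding s2 by (simp add: power2_eq_square power3_eq_cube)
  also have "\<dots> = (\<integral>\<^sup>+t. ennreal (\<eta>\<^sup>2 / 8 * t) * indicator {r..s} t \<partial>lborel)"
    by (rule nn_integral_linear_Icc[symmetric]) (use rs r in auto)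
  also have "\<dots> \<le> (\<integral>\<^sup>+t. ennreal (1 / 2 * (max 0 ((ramp a t)\<^sup>2 - (F t)\<^sup>2))\<^sup>2 * t) \<partial>\<mu>\<^sub>+)"
    unfolding nn_integral_Ioi_borel
  proof (rule nn_integral_mono)
    fix t
    show "ennreal (\<eta>\<^sup>2 / 8 * t) * indicator {r..s} t
      \<le> ennreal (1 / 2 * (max 0 ((ramp a t)\<^sup>2 - (F t)\<^sup>2))\<^sup>2 * t) * indicator {0<..} t"
    proof (cases "t \<in> {r..s}")
      case True
      have "\<eta>\<^sup>2 / 8 = 1 / 2 * (\<eta> / 2)\<^sup>2" by (simp add: power_divide)
      also have "\<dots> \<le> 1 / 2 * (max 0 ((ramp a t)\<^sup>2 - (F t)\<^sup>2))\<^sup>2"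
        by (intro mult_left_mono power_mono D[OF True]) (use \<eta>(2) in auto)
      finally have "\<eta>\<^sup>2 / 8 * t \<le> 1 / 2 * (max 0 ((ramp a t)\<^sup>2 - (F t)\<^sup>2))\<^sup>2 * t"
        using True r by (intro mult_right_mono) auto
      then show ?thesis using True r by (simp add: ennreal_leI)
    qed simp
  qed
  also have "\<dots> \<le> ennreal (q powr (p / 2 - 1) * (1 + 1 / (p - 2)))"
    using ramp_deficit_integral[OF q a] grad_energy_ramp[OF p q a] by (rule order_trans)
  finally show ?thesis using p q by (subst (asm) ennreal_le_iff) auto
qed

end

section \<open>The rate of convergence\<close>

lemma f_inf_nonneg: "0 \<le> r \<Longrightarrow> 0 \<le> f_inf r"
  by (simp add: f_inf_def)

lemma f_inf_le_1: "f_inf r \<le> 1"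
  by (simp add: f_inf_def)

text \<open>In both regimes \<open>q * (f_inf r)\<^sup>2 \<le> (ramp a r)\<^sup>2\<close>, and
  \<open>f_inf\<close> is at most 1.\<close>

lemma f_inf_square_minus_ramp_square:
  assumes q: "0 < q" "q \<le> 1" and a: "a = sqrt (q / 2)" and r: "0 < r"
  shows "(f_inf r)\<^sup>2 - (ramp a r)\<^sup>2 \<le> 1 - q"
proof (cases "r < sqrt 2")
  case True
  have "r\<^sup>2 < (sqrt 2)\<^sup>2" using True r by (intro power_strict_mono) auto
  then have r2: "r\<^sup>2 / 2 \<le> 1" by simp
  have ar: "(a * r)\<^sup>2 = q * (r\<^sup>2 / 2)" using q by (simp add: a power_mult_distrib)
  also have "\<dots> \<le> 1" using q r2 by (intro mult_le_one) auto
  finally have "a * r \<le> 1" using abs_square_le_1[of "a * r"] by simp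
  then have "(ramp a r)\<^sup>2 = q * (r\<^sup>2 / 2)" using ar by (simp add: ramp_def)
  moreover have "(f_inf r)\<^sup>2 = r\<^sup>2 / 2" using True by (simp add: f_inf_def power_divide)
  ultimately have "(f_inf r)\<^sup>2 - (ramp a r)\<^sup>2 = (1 - q) * (r\<^sup>2 / 2)" by (simp add: left_diff_distrib)
  also have "\<dots> \<le> 1 - q" using q r2 by (intro mult_left_le) auto
  finally show ?thesis .
next
  case False
  have "sqrt q \<le> a * r"
  proof -
    have "sqrt q = a * sqrt 2" by (simp add: a real_sqrt_mult[symmetric])
    also have "\<dots> \<le> a * r" using False q by (intro mult_left_mono) (auto simp: a)
    finally show ?thesis .
  qed
  then have "sqrt q \<le> ramp a r" using q by (simp add: ramp_def)
  then have "(sqrt q)\<^sup>2 \<le> (ramp a r)\<^sup>2" using q by (intro power_mono) auto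
  then show ?thesis using False q by (simp add: f_inf_def)
qed

text \<open>For non-negative numbers the difference is dominated by the sum. This is where the
  exponent 1 / 2 of the final rate arises.\<close>

lemma abs_diff_le_sqrt_abs_diff_squares:
  fixes x y :: real
  assumes "0 \<le> x" "0 \<le> y"
  shows "\<bar>x - y\<bar> \<le> sqrt \<bar>x\<^sup>2 - y\<^sup>2\<bar>"
proof (rule real_le_rsqrt)
  have "\<bar>x - y\<bar>\<^sup>2 \<le> \<bar>x - y\<bar> * \<bar>x + y\<bar>"
    unfolding power2_eq_square using assms by (intro mult_left_mono) auto
  also have "\<dots> = \<bar>x\<^sup>2 - y\<^sup>2\<bar>" by (simp add: abs_mult[symmetric] power2_eq_square algebra_simps)
  finally show "\<bar>x - y\<bar>\<^sup>2 \<le> \<bar>x\<^sup>2 - y\<^sup>2\<bar>" .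
qed

context energy_minimizer
begin

text \<open>The ramp of slope \<open>sqrt (q / 2)\<close> with \<open>q = exp (- 12 ln p / p)\<close> costs only \<open>ln p / p\<close> in the
  uniform distance to \<open>f_inf\<close>, while its gradient energy is at most \<open>2 / p ^ 3\<close>.\<close>

lemma square_deviation:
  assumes p4: "p \<ge> 4" and r: "0 < r" and F1: "F r \<le> 1"
  shows "\<bar>(F r)\<^sup>2 - (f_inf r)\<^sup>2\<bar> \<le> (45 * exp 6 + 2) * (ln p / p)"
proof -
  \<comment> \<open>The factor 12 is 3 times 4: since \<open>p / 2 - 1 \<ge> p / 4\<close> for
    \<open>p \<ge> 4\<close>, the exponent \<open>\<delta> * (p / 2 - 1)\<close> is at least
    \<open>3 * ln p\<close>, which makes \<kappa> at most \<open>1 / p ^ 3\<close>.\<close>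
  define \<delta> where "\<delta> = 12 * ln p / p"
  define q where "q = exp (- \<delta>)"
  define L where "L = exp \<delta>"
  \<comment> \<open>A bound on \<open>L\<close> independent of \<open>p\<close>, from
    \<open>\<delta> \<le> 6\<close>. The constant \<open>M\<close> defined next bounds the energy of
    the ramp, \<open>2 * \<kappa> + L / 2\<close>.\<close>
  define E :: real where "E = exp 6"
  define M where "M = 2 + E"
  define \<kappa> where "\<kappa> = L powr (1 - p / 2)"
  define a where "a = sqrt (q / 2)"
  have lnp1: "1 \<le> ln p"
  proof -
    have "exp 1 \<le> p" using exp_le p4 by linarith
    then show ?thesis using p4 by (subst ln_ge_iff) auto
  qed
  \<comment> \<open>Splitting off \<open>ln 2\<close> lets the tangent bound at 1, used for each
    summand, add up to exactly \<open>p / 2\<close>.\<close>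
  have "ln p = ln 2 + ln (p / 2)" using p4 by (simp add: ln_div)
  also have "\<dots> \<le> p / 2" using ln_le_minus_one[of 2] ln_le_minus_one[of "p / 2"] p4 by simp
  finally have lnp2: "ln p \<le> p / 2" .
  have \<delta>: "0 \<le> \<delta>" "\<delta> \<le> 6" using lnp1 lnp2 p4 by (auto simp: \<delta>_def field_simps)
  have q: "0 < q" "q \<le> 1" using \<delta> by (auto simp: q_def)
  have L: "0 < L" "L \<le> E" "1 \<le> L" using \<delta> by (auto simp: L_def E_def)
  have E1: "1 \<le> E" by (simp add: E_def)
  have qL: "q * L = 1" by (simp add: q_def L_def exp_minus)
  have q\<kappa>: "q powr (p / 2 - 1) = \<kappa>"
    by (simp add: q_def \<kappa>_def L_def powr_def algebra_simps)
  have \<kappa>: "\<kappa> \<le> 1 / p ^ 3"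
  proof -
    have le: "\<delta> * (p / 4) \<le> \<delta> * (p / 2 - 1)" using \<delta> p4 by (intro mult_left_mono) auto
    have "\<kappa> = exp (- (\<delta> * (p / 2 - 1)))" by (simp add: \<kappa>_def L_def powr_def algebra_simps)
    also have "\<dots> \<le> exp (- (\<delta> * (p / 4)))" using le by (simp only: exp_le_cancel_iff neg_le_iff_le)
    also have "\<delta> * (p / 4) = 3 * ln p" using p4 by (simp add: \<delta>_def)
    also have "exp (- (3 * ln p)) = 1 / p ^ 3"
      using p4 exp_of_nat_mult[of 3 "ln p"] by (simp add: exp_minus inverse_eq_divide)
    finally show ?thesis .
  qed
  have \<kappa>0: "0 \<le> \<kappa>" by (simp add: \<kappa>_def)
  have "p ^ 1 \<le> p ^ 3" using p4 by (intro power_increasing) auto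
  then have "1 / p ^ 3 \<le> 1 / p" using p4 by (intro divide_left_mono) auto
  with \<kappa> have \<kappa>p: "\<kappa> \<le> 1 / p" by linarith
  have \<kappa>1: "\<kappa> \<le> 1" using \<kappa>p p4 by (simp add: order_trans[of \<kappa> "1 / p" 1])
  have p2: "1 + 1 / (p - 2) \<le> 2" using p4 by (simp add: field_simps)
  have M0: "0 \<le> M" using E1 by (simp add: M_def)
  have M: "grad_energy p F g \<le> ennreal M"
  proof -
    have "grad_energy p F g \<le> ennreal (\<kappa> * (1 + 1 / (p - 2)) + 1 / (2 * q))"
      using order_trans[OF grad_energy_le_energy energy_le_ramp[OF q]] by (simp only: q\<kappa>)
    also have "\<kappa> * (1 + 1 / (p - 2)) + 1 / (2 * q) \<le> M"
    proof -
      have "\<kappa> * (1 + 1 / (p - 2)) \<le> 1 * 2" using \<kappa>0 \<kappa>1 p2 p4 by (intro mult_mono) auto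
      moreover have "1 / (2 * q) = L / 2" using qL q by (simp add: field_simps)
      ultimately show ?thesis using L by (simp add: M_def)
    qed
    finally show ?thesis by (simp add: ennreal_leI)
  qed
  have \<kappa>M: "\<kappa> * M \<le> M / p" using mult_right_mono[OF \<kappa>p M0] by simp
  have lower: "(f_inf r)\<^sup>2 - (F r)\<^sup>2 \<le> \<delta> + (32 * E + M) / p"
  proof -
    define \<eta> where "\<eta> = (ramp a r)\<^sup>2 - (F r)\<^sup>2 - L powr (1 - p / 2) * M"
    have "\<eta> \<le> 32 * E / p"
    proof (cases "\<eta> > 0")
      case True
      have "\<eta> ^ 3 / (16 * L) \<le> \<kappa> * (1 + 1 / (p - 2))"
        using ramp_deficit_sup[OF M M0 r L(1) q a_def \<eta>_def True] by (simp only: q\<kappa>)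
      also have "\<dots> \<le> 1 / p ^ 3 * 2" using \<kappa> \<kappa>0 p2 p4 by (intro mult_mono) auto
      finally have "\<eta> ^ 3 \<le> 32 * L / p ^ 3" using L by (simp add: field_simps)
      \<comment> \<open>A wasteful constant, chosen so that both sides are cubes and no root of
        \<open>L\<close> appears.\<close>
      also have "\<dots> \<le> (32 * E) ^ 3 / p ^ 3"
      proof (rule divide_right_mono)
        have "32 * L \<le> (32 * E) ^ 1" using L by simp
        also have "\<dots> \<le> (32 * E) ^ 3" using E1 by (intro power_increasing) auto
        finally show "32 * L \<le> (32 * E) ^ 3" .
      qed (use p4 in auto)
      also have "\<dots> = (32 * E / p) ^ 3" by (simp add: power_divide)
      finally have "\<eta> ^ Suc 2 \<le> (32 * E / p) ^ Suc 2" by (simp add: numeral_3_eq_3 numeral_2_eq_2)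
      then show ?thesis by (rule power_le_imp_le_base) (use E1 p4 in auto)
    next
      case False
      moreover have "0 \<le> 32 * E / p" using E1 p4 by auto
      ultimately show ?thesis by linarith
    qed
    then have "(ramp a r)\<^sup>2 - (F r)\<^sup>2 \<le> 32 * E / p + M / p" using \<kappa>M by (simp add: \<eta>_def \<kappa>_def)
    moreover have "(f_inf r)\<^sup>2 - (ramp a r)\<^sup>2 \<le> 1 - q"
      by (rule f_inf_square_minus_ramp_square[OF q a_def r])
    moreover have "1 - q \<le> \<delta>" using exp_ge_add_one_self[of "- \<delta>"] by (simp add: q_def)
    ultimately show ?thesis by (simp add: add_divide_distrib)
  qed
  have upper: "(F r)\<^sup>2 - (f_inf r)\<^sup>2 \<le> \<delta> * E + M / p"
  proof (cases "r < sqrt 2")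
    case True
    have "r\<^sup>2 < (sqrt 2)\<^sup>2" using True r by (intro power_strict_mono) auto
    then have r2: "r\<^sup>2 / 2 \<le> 1" by simp
    have "1 - \<delta> \<le> q" using exp_ge_add_one_self[of "- \<delta>"] by (simp add: q_def)
    \<comment> \<open>Multiplying the tangent bound for \<open>q\<close> by its inverse
      \<open>L\<close> bounds \<open>L - 1\<close> linearly in \<delta>.\<close>
    then have "(1 - \<delta>) * L \<le> q * L" using L by (intro mult_right_mono) auto
    then have "L - 1 \<le> \<delta> * L" unfolding qL by (simp add: algebra_simps)
    also have "\<dots> \<le> \<delta> * E" using \<delta> L by (intro mult_left_mono)
    finally have L1: "L - 1 \<le> \<delta> * E" .
    have "(F r)\<^sup>2 \<le> L * r\<^sup>2 / 2 + \<kappa> * M"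
      using square_upper[OF M M0 p4 r L(1)] by (simp add: \<kappa>_def)
    moreover have "(f_inf r)\<^sup>2 = r\<^sup>2 / 2" using True by (simp add: f_inf_def power_divide)
    moreover have "(L - 1) * (r\<^sup>2 / 2) \<le> L - 1" using r2 L by (intro mult_left_le) auto
    moreover have "(L - 1) * (r\<^sup>2 / 2) = L * r\<^sup>2 / 2 - r\<^sup>2 / 2" by (simp add: left_diff_distrib)
    ultimately show ?thesis using L1 \<kappa>M by linarith
  next
    case False
    have "(F r)\<^sup>2 \<le> 1" using F1 F_nonneg[of r] by (simp add: abs_square_le_1)
    moreover have "0 \<le> \<delta> * E + M / p" using \<delta> E1 M0 p4 by (intro add_nonneg_nonneg mult_nonneg_nonneg) auto
    ultimately show ?thesis using False by (simp add: f_inf_def)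
  qed
  have "\<delta> \<le> \<delta> * E" using mult_left_mono[OF E1 \<delta>(1)] by simp
  moreover have "M / p \<le> (32 * E + M) / p" using E1 p4 by (intro divide_right_mono) auto
  ultimately have "\<bar>(F r)\<^sup>2 - (f_inf r)\<^sup>2\<bar> \<le> \<delta> * E + (32 * E + M) / p"
    using lower upper by linarith
  also have "\<dots> \<le> \<delta> * E + (32 * E + M) * (ln p / p)"
  proof -
    \<comment> \<open>Errors of order \<open>1 / p\<close> are absorbed because
      \<open>1 \<le> ln p\<close>. In total the coefficient becomes 12 E + 32 E + 2 + E.\<close>
    have "(32 * E + M) * (1 / p) \<le> (32 * E + M) * (ln p / p)"
      using E1 M0 lnp1 p4 by (intro mult_left_mono divide_right_mono) auto
    then show ?thesis by simp
  qed
  also have "\<dots> = (45 * exp 6 + 2) * (ln p / p)"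
    by (simp add: \<delta>_def M_def E_def algebra_simps)
  finally show ?thesis .
qed

text \<open>The summand 3 covers \<open>p < 4\<close>: there \<open>ln p / p\<close> is at least 1 /
  9, so three times its root already exceeds the trivial bound 1. Adding it to the constant for
  \<open>p \<ge> 4\<close> gives one constant for all \<open>p\<close>.\<close>

lemma deviation:
  assumes r: "0 < r" and F1: "F r \<le> 1"
  shows "\<bar>F r - f_inf r\<bar> \<le> (sqrt (45 * exp 6 + 2) + 3) * (ln p / p) powr (1 / 2)"
proof -
  have lnp: "0 < ln p" using p by simp
  have half: "(ln p / p) powr (1 / 2) = sqrt (ln p / p)" using lnp p by (simp add: powr_half_sqrt)
  have fi: "0 \<le> f_inf r" "f_inf r \<le> 1" using f_inf_nonneg[of r] f_inf_le_1[of r] r by auto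
  have s0: "0 \<le> sqrt (ln p / p)" using lnp p by simp
  show ?thesis
  proof (cases "p \<ge> 4")
    case True
    have "\<bar>F r - f_inf r\<bar> \<le> sqrt \<bar>(F r)\<^sup>2 - (f_inf r)\<^sup>2\<bar>"
      by (rule abs_diff_le_sqrt_abs_diff_squares[OF F_nonneg fi(1)])
    also have "\<dots> \<le> sqrt ((45 * exp 6 + 2) * (ln p / p))"
      by (rule real_sqrt_le_mono[OF square_deviation[OF True r F1]])
    also have "\<dots> = sqrt (45 * exp 6 + 2) * sqrt (ln p / p)" by (rule real_sqrt_mult)
    also have "\<dots> \<le> (sqrt (45 * exp 6 + 2) + 3) * sqrt (ln p / p)"
      using s0 by (intro mult_right_mono) auto
    finally show ?thesis by (simp only: half)
  next
    case False
    have "1 / 2 \<le> ln p"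
    proof -
      have "ln (1 / 2) \<le> 1 / 2 - (1::real)" by (rule ln_le_minus_one) simp
      then have "1 / 2 \<le> ln (2::real)" by (simp add: ln_div)
      also have "\<dots> \<le> ln p" using p by simp
      finally show ?thesis .
    qed
    then have "1 / 9 \<le> ln p / p" using False p by (simp add: field_simps)
    then have "sqrt (1 / 9) \<le> sqrt (ln p / p)" by (rule real_sqrt_le_mono)
    moreover have "sqrt (1 / 9) = (1 / 3 :: real)" by (simp add: real_sqrt_divide)
    ultimately have "1 \<le> 3 * sqrt (ln p / p)" by simp
    also have "\<dots> \<le> (sqrt (45 * exp 6 + 2) + 3) * sqrt (ln p / p)"
      using s0 by (intro mult_right_mono) auto
    finally show ?thesis using fi F1 F_nonneg[of r] unfolding half by linarith
  qed
qed

end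

theorem theorem1:
  shows "\<exists>C::real. C > 0 \<and>
    (\<forall>p::real. p > 2 \<longrightarrow>
      (\<forall>fp. nonneg_minimizer p fp \<longrightarrow>
        Linf_norm (\<lambda>r. fp r - f_inf r) \<le> ereal (C * (ln p / p) powr (1 / 2))))"
proof (intro exI[of _ "sqrt (45 * exp 6 + 2) + 3"] conjI allI impI)
  show "sqrt (45 * exp 6 + 2) + 3 > (0::real)" by (simp add: add_nonneg_pos)
  fix p :: real and fp
  assume p: "p > 2" and m: "nonneg_minimizer p fp"
  obtain F g where Fg: "loc_ac F g" and fF: "AE r in \<mu>\<^sub>+. fp r = F r"
    and "\<And>r. 0 \<le> F r" "grad_energy p F g < \<infinity>"
    "\<And>G k. loc_ac G k \<Longrightarrow> grad_energy p G k < \<infinity> \<Longrightarrow> energy p F g \<le> energy p G k"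
    using nonneg_minimizer_representative[OF m] p by auto
  then interpret energy_minimizer p F g using p by unfold_locales
  show "Linf_norm (\<lambda>r. fp r - f_inf r) \<le> ereal ((sqrt (45 * exp 6 + 2) + 3) * (ln p / p) powr (1 / 2))"
    unfolding Linf_norm_def
  proof (rule esssup_I)
    have [measurable]: "fp \<in> borel_measurable \<mu>\<^sub>+"
      using m by (auto simp: nonneg_minimizer_def Xp_def W1p_loc_def Lp_loc_def)
    have [measurable]: "f_inf \<in> borel_measurable \<mu>\<^sub>+" unfolding f_inf_def[abs_def] by measurable
    show "(\<lambda>r. ereal \<bar>fp r - f_inf r\<bar>) \<in> borel_measurable \<mu>\<^sub>+" by measurable
    show "AE r in \<mu>\<^sub>+. ereal \<bar>fp r - f_inf r\<bar> \<le> ereal ((sqrt (45 * exp 6 + 2) + 3) * (ln p / p) powr (1 / 2))"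
      using fF AE_le_1 AE_Ioi by eventually_elim (simp only: ereal_less_eq deviation)
  qed
qed

end
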